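(* Let $(R,\mathfrak m)$ be a one-dimensional, analytically unramified, Cohen-Macaulay (Noetherian) local ring with infinite residue field and embedding dimension $\nu$. Let $\overline R$ be the integral closure of $R$ in its total ring of fractions, and assume that the conductor $\mathfrak c=R:\overline R$ is $\mathfrak m$-primary (i.e. $R$ is not a discrete valuation ring). If $R$ is almost Gorenstein, then $$e(\mathfrak c)\le \nu\cdot \ell(R/\mathfrak c).$$
   Context: Analytically unramified means that the $\mathfrak m$-adic completion $\hat R$ is reduced; in the present setting this is equivalent to $\overline R$ being a finite $R$-module. $Q(R)$ denotes the total ring of fractions of $R$. For $R$-submodules $I,J$ of $Q(R)$, $I:J=\{z\in Q(R) : zJ\subseteq I\}$; thus $\mathfrak c=R:\overline R$ is the conductor and $\mathfrak m:\mathfrak m=\{z\in Q(R): z\mathfrak m\subseteq\mathfrak m\}$. $\ell$ denotes length as an $R$-module, $e(\mathfrak c)$ is the Hilbert-Samuel multiplicity of the $\mathfrak m$-primary ideal $\mathfrak c$ (on $R$), and $\nu=\dim_{R/\mathfrak m}\mathfrak m/\mathfrak m^2$ is the embedding dimension. All fractional ideals are assumed to contain a non-zero divisor of $Q(R)$. A canonical ideal of $R$ is a fractional ideal $\omega$ such that $J=\omega:(\omega:J)$ for every fractional ideal $J$ of $R$ (equivalently, a fractional ideal isomorphic to a canonical module of $R$). When $(R,\mathfrak m)$ is a one-dimensional, analytically unramified, Cohen-Macaulay (Noetherian) local ring with infinite residue field, canonical ideals exist, any two of them differ by multiplication by a non-zero divisor of $Q(R)$, and one can always choose a canonical ideal $\omega$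 with $R\subseteq\omega\subseteq\overline R$. The ring $R$ is called almost Gorenstein if $\omega\subseteq\mathfrak m:\mathfrak m$, where $\omega$ is any canonical ideal with $R\subseteq\omega\subseteq\overline R$ (this does not depend on the choice of such $\omega$). *)

theory Defs
  imports
    Complex_Main
    "HOL-Library.Extended_Nat"
    "HOL-Computational_Algebra.Polynomial"
begin

text \<open>
  The ring \<open>R\<close> is (the universe of) a type \<open>'a :: comm_ring_1\<close>. Its total ring of fractions \<open>Q(R)\<close> is
  the type \<open>'a tfrac\<close> below, with embedding \<open>of_ring :: 'a \<Rightarrow> 'a tfrac\<close>. Ideals of \<open>R\<close> and
  \<open>R\<close>-submodules of \<open>Q(R)\<close> are sets, and are the submodules (\<open>subspace\<close>) of the library locale
  \<open>module\<close> for the respective scalar multiplications.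
\<close>

section \<open>The total ring of fractions\<close>

definition non_zero_divisor :: "'a::comm_ring_1 \<Rightarrow> bool" where
  "non_zero_divisor a \<longleftrightarrow> (\<forall>x. a * x = 0 \<longrightarrow> x = 0)"

lemma non_zero_divisor_1 [simp]: "non_zero_divisor 1"
  by (simp add: non_zero_divisor_def)

lemma non_zero_divisor_mult [simp]:
  "non_zero_divisor a \<Longrightarrow> non_zero_divisor b \<Longrightarrow> non_zero_divisor (a * b)"
  unfolding non_zero_divisor_def by (metis mult.assoc)

lemma non_zero_divisor_cancel:
  assumes "non_zero_divisor a" "a * x = a * y"
  shows "x = y"
proof -
  have "a * (x - y) = 0"
    using assms(2) by (simp add: right_diff_distrib)
  then have "x - y = 0"
    using assms(1) unfolding non_zero_divisor_def by blast
  then show ?thesis by simp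
qed

definition tfrac_rel :: "'a::comm_ring_1 \<times> 'a \<Rightarrow> 'a \<times> 'a \<Rightarrow> bool" where
  "tfrac_rel = (\<lambda>x y. non_zero_divisor (snd x) \<and> non_zero_divisor (snd y)
     \<and> fst x * snd y = fst y * snd x)"

lemma tfrac_rel_iff [simp]:
  "tfrac_rel x y \<longleftrightarrow> non_zero_divisor (snd x) \<and> non_zero_divisor (snd y)
     \<and> fst x * snd y = fst y * snd x"
  by (simp add: tfrac_rel_def)

lemma part_equivp_tfrac_rel: "part_equivp (tfrac_rel :: 'a::comm_ring_1 \<times> 'a \<Rightarrow> _)"
proof (rule part_equivpI)
  show "\<exists>x::'a \<times> 'a. tfrac_rel x x"
    by (rule exI [where x = "(0, 1)"]) simp
  show "symp (tfrac_rel :: 'a \<times> 'a \<Rightarrow> _)"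
    by (auto intro!: sympI)
  show "transp (tfrac_rel :: 'a \<times> 'a \<Rightarrow> _)"
  proof (rule transpI)
    fix x y z :: "'a \<times> 'a"
    assume xy: "tfrac_rel x y" and yz: "tfrac_rel y z"
    from xy have e1: "fst x * snd y = fst y * snd x" by simp
    from yz have e2: "fst y * snd z = fst z * snd y" by simp
    have "snd y * (fst x * snd z) = (fst x * snd y) * snd z"
      by (simp add: ac_simps)
    also have "\<dots> = (fst y * snd z) * snd x"
      by (simp only: e1) (simp add: ac_simps)
    also have "\<dots> = snd y * (fst z * snd x)"
      by (simp only: e2) (simp add: ac_simps)
    finally have "snd y * (fst x * snd z) = snd y * (fst z * snd x)" .
    moreover have "non_zero_divisor (snd y)"
      using xy by simp
    ultimately have "fst x * snd z = fst z * snd x"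
      by (rule non_zero_divisor_cancel [rotated])
    with xy yz show "tfrac_rel x z"
      unfolding tfrac_rel_iff by blast
  qed
qed

quotient_type (overloaded) 'a tfrac = "'a::comm_ring_1 \<times> 'a" / partial: tfrac_rel
  by (rule part_equivp_tfrac_rel)

instantiation tfrac :: (comm_ring_1) comm_ring_1
begin

lift_definition zero_tfrac :: "'a tfrac" is "(0, 1)" by simp

lift_definition one_tfrac :: "'a tfrac" is "(1, 1)" by simp

lift_definition plus_tfrac :: "'a tfrac \<Rightarrow> 'a tfrac \<Rightarrow> 'a tfrac"
  is "\<lambda>x y. (fst x * snd y + fst y * snd x, snd x * snd y)"
proof -
  fix x x' y y' :: "'a \<times> 'a"
  assume x: "tfrac_rel x x'" and y: "tfrac_rel y y'"
  have "(fst x * snd y + fst y * snd x) * (snd x' * snd y') =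
      (fst x * snd x') * (snd y * snd y') + (fst y * snd y') * (snd x * snd x')"
    by (simp add: algebra_simps)
  also have "\<dots> = (fst x' * snd x) * (snd y * snd y') + (fst y' * snd y) * (snd x * snd x')"
    using x y by simp
  also have "\<dots> = (fst x' * snd y' + fst y' * snd x') * (snd x * snd y)"
    by (simp add: algebra_simps)
  finally show "tfrac_rel (fst x * snd y + fst y * snd x, snd x * snd y)
      (fst x' * snd y' + fst y' * snd x', snd x' * snd y')"
    using x y by simp
qed

lift_definition uminus_tfrac :: "'a tfrac \<Rightarrow> 'a tfrac" is "\<lambda>x. (- fst x, snd x)"
  by simp

lift_definition times_tfrac :: "'a tfrac \<Rightarrow> 'a tfrac \<Rightarrow> 'a tfrac"
  is "\<lambda>x y. (fst x * fst y, snd x * snd y)"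
proof -
  fix x x' y y' :: "'a \<times> 'a"
  assume x: "tfrac_rel x x'" and y: "tfrac_rel y y'"
  have "(fst x * fst y) * (snd x' * snd y') = (fst x * snd x') * (fst y * snd y')"
    by (simp add: ac_simps)
  also have "\<dots> = (fst x' * snd x) * (fst y' * snd y)"
    using x y by simp
  also have "\<dots> = (fst x' * fst y') * (snd x * snd y)"
    by (simp add: ac_simps)
  finally show "tfrac_rel (fst x * fst y, snd x * snd y) (fst x' * fst y', snd x' * snd y')"
    using x y by simp
qed

definition minus_tfrac :: "'a tfrac \<Rightarrow> 'a tfrac \<Rightarrow> 'a tfrac" where
  "x - y = x + - (y :: 'a tfrac)"

instance
proof
  fix x y z :: "'a tfrac"
  show "x + y + z = x + (y + z)" by transfer (simp add: algebra_simps)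
  show "x + y = y + x" by transfer (simp add: algebra_simps)
  show "0 + x = x" by transfer (simp add: algebra_simps)
  show "- x + x = 0" by transfer (simp add: algebra_simps)
  show "x - y = x + - y" by (rule minus_tfrac_def)
  show "x * y * z = x * (y * z)" by transfer (simp add: algebra_simps)
  show "x * y = y * x" by transfer (simp add: algebra_simps)
  show "1 * x = x" by transfer (simp add: algebra_simps)
  show "(x + y) * z = x * z + y * z" by transfer (simp add: algebra_simps)
  show "(0 :: 'a tfrac) \<noteq> 1" by transfer simp
qed

end

lift_definition of_ring :: "'a::comm_ring_1 \<Rightarrow> 'a tfrac" is "\<lambda>a. (a, 1)" by simp

lemma of_ring_0 [simp]: "of_ring 0 = 0" by transfer simp
lemma of_ring_1 [simp]: "of_ring 1 = 1" by transfer simp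
lemma of_ring_add: "of_ring (a + b) = of_ring a + of_ring b" by transfer simp
lemma of_ring_mult: "of_ring (a * b) = of_ring a * of_ring b" by transfer simp
lemma of_ring_eq_iff [simp]: "of_ring a = of_ring b \<longleftrightarrow> a = b" by transfer simp

lift_definition tfrac_inverse_of :: "'a::comm_ring_1 \<Rightarrow> 'a tfrac"
  is "\<lambda>b. if non_zero_divisor b then (1, b) else (0, 1)" by simp

lemma of_ring_mult_inverse:
  assumes "non_zero_divisor b"
  shows "of_ring b * tfrac_inverse_of b = 1"
  using assms by transfer simp

lemma tfrac_is_fraction:
  obtains a b where "non_zero_divisor b" "z = of_ring a * tfrac_inverse_of b"
proof -
  have "\<exists>a b. non_zero_divisor b \<and> z = of_ring a * tfrac_inverse_of b"
  proof (transfer)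
    fix z :: "'a \<times> 'a"
    assume "tfrac_rel z z"
    then show "\<exists>a b. non_zero_divisor b \<and>
        tfrac_rel z (fst (a, 1) * fst (if non_zero_divisor b then (1, b) else (0, 1)),
          snd (a, 1) * snd (if non_zero_divisor b then (1, b) else (0, 1)))"
      by (intro exI [where x = "fst z"] exI [where x = "snd z"]) simp
  qed
  then show ?thesis using that by blast
qed


section \<open>Ideals and local rings\<close>

lemma module_ring: "module ((*) :: 'a::comm_ring_1 \<Rightarrow> 'a \<Rightarrow> 'a)"
  by unfold_locales (simp_all add: algebra_simps)

abbreviation ideal :: "'a::comm_ring_1 set \<Rightarrow> bool" where
  "ideal \<equiv> module.subspace (*)"

abbreviation ideal_generated :: "'a::comm_ring_1 set \<Rightarrow> 'a set" where
  "ideal_generated \<equiv> module.span (*)"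

definition noetherian :: "'a::comm_ring_1 itself \<Rightarrow> bool" where
  "noetherian TYPE('a) \<longleftrightarrow>
     (\<forall>I :: 'a set. ideal I \<longrightarrow> (\<exists>B. finite B \<and> I = ideal_generated B))"

definition prime_ideal :: "'a::comm_ring_1 set \<Rightarrow> bool" where
  "prime_ideal p \<longleftrightarrow> ideal p \<and> p \<noteq> UNIV \<and> (\<forall>x y. x * y \<in> p \<longrightarrow> x \<in> p \<or> y \<in> p)"

definition maximal_ideal :: "'a::comm_ring_1 set \<Rightarrow> bool" where
  "maximal_ideal m \<longleftrightarrow> ideal m \<and> m \<noteq> UNIV \<and>
     (\<forall>I. ideal I \<longrightarrow> m \<subseteq> I \<longrightarrow> I = m \<or> I = UNIV)"

definition noetherian_local_ring :: "'a::comm_ring_1 set \<Rightarrow> bool" where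
  "noetherian_local_ring m \<longleftrightarrow> noetherian TYPE('a) \<and> {M :: 'a set. maximal_ideal M} = {m}"

definition ideal_radical :: "'a::comm_ring_1 set \<Rightarrow> 'a set" where
  "ideal_radical I = {x. \<exists>n. x ^ n \<in> I}"

definition primary_ideal :: "'a::comm_ring_1 set \<Rightarrow> bool" where
  "primary_ideal q \<longleftrightarrow> ideal q \<and> q \<noteq> UNIV \<and>
     (\<forall>x y. x * y \<in> q \<longrightarrow> x \<in> q \<or> (\<exists>n. y ^ n \<in> q))"

definition primary_to :: "'a::comm_ring_1 set \<Rightarrow> 'a set \<Rightarrow> bool" where
  "primary_to p q \<longleftrightarrow> primary_ideal q \<and> ideal_radical q = p"

definition ideal_mult :: "'a::comm_ring_1 set \<Rightarrow> 'a set \<Rightarrow> 'a set" where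
  "ideal_mult I J = ideal_generated {a * b | a b. a \<in> I \<and> b \<in> J}"

primrec ideal_power :: "'a::comm_ring_1 set \<Rightarrow> nat \<Rightarrow> 'a set" where
  "ideal_power I 0 = UNIV"
| "ideal_power I (Suc n) = ideal_mult I (ideal_power I n)"

definition krull_dim :: "'a::comm_ring_1 itself \<Rightarrow> enat" where
  "krull_dim TYPE('a) = Sup {enat n | n. \<exists>p :: nat \<Rightarrow> 'a set.
     (\<forall>i\<le>n. prime_ideal (p i)) \<and> (\<forall>i<n. p i \<subset> p (Suc i))}"

definition regular_sequence :: "'a::comm_ring_1 list \<Rightarrow> bool" where
  "regular_sequence xs \<longleftrightarrow> ideal_generated (set xs) \<noteq> UNIV \<and>
     (\<forall>i<length xs. \<forall>y. xs ! i * y \<in> ideal_generated (set (take i xs))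
        \<longrightarrow> y \<in> ideal_generated (set (take i xs)))"

text \<open>The depth of a Noetherian local ring with maximal ideal \<open>m\<close>.\<close>

definition depth :: "'a::comm_ring_1 set \<Rightarrow> enat" where
  "depth m = Sup {enat (length xs) | xs. set xs \<subseteq> m \<and> regular_sequence xs}"

definition cohen_macaulay :: "'a::comm_ring_1 set \<Rightarrow> bool" where
  "cohen_macaulay m \<longleftrightarrow> depth m = krull_dim TYPE('a)"


section \<open>Residue classes and the adic completion\<close>

definition residue_class :: "'a::comm_ring_1 set \<Rightarrow> 'a \<Rightarrow> 'a set" where
  "residue_class I x = {y. y - x \<in> I}"

definition residue_ring :: "'a::comm_ring_1 set \<Rightarrow> 'a set set" where
  "residue_ring I = range (residue_class I)"

definition residue_mult :: "'a::comm_ring_1 set \<Rightarrow> 'a set \<Rightarrow> 'a set \<Rightarrow> 'a set" where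
  "residue_mult I A B = (\<Union>a\<in>A. \<Union>b\<in>B. residue_class I (a * b))"

lemma residue_mult_residue_class:
  assumes I: "ideal I"
  shows "residue_mult I (residue_class I x) (residue_class I y) = residue_class I (x * y)"
proof -
  have "residue_class I (a * b) = residue_class I (x * y)"
    if "a - x \<in> I" "b - y \<in> I" for a b
  proof -
    have "b * (a - x) + x * (b - y) \<in> I"
      by (intro module.subspace_add [OF module_ring I] module.subspace_scale [OF module_ring I] that)
    then have *: "a * b - x * y \<in> I"
      by (simp add: algebra_simps)
    have "z - a * b \<in> I \<longleftrightarrow> z - x * y \<in> I" for z
    proof
      assume "z - a * b \<in> I"
      from module.subspace_add [OF module_ring I this *] show "z - x * y \<in> I" by simp
    next
      assume "z - x * y \<in> I"
      from module.subspace_diff [OF module_ring I this *] show "z - a * b \<in> I" by simp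
    qed
    then show ?thesis
      by (simp add: residue_class_def)
  qed
  then have "residue_mult I (residue_class I x) (residue_class I y) =
      (\<Union>a\<in>residue_class I x. \<Union>b\<in>residue_class I y. residue_class I (x * y))"
    unfolding residue_mult_def by (intro SUP_cong refl) (simp add: residue_class_def)
  moreover have "x \<in> residue_class I x" "y \<in> residue_class I y"
    using module.subspace_0 [OF module_ring I] by (simp_all add: residue_class_def)
  ultimately show ?thesis
    by blast
qed

text \<open>
  The \<open>I\<close>-adic completion is the inverse limit of the rings \<open>R/I\<^sup>n\<close>. The transition maps
  send a class modulo \<open>I\<close>-power \<open>n + 1\<close> to the class modulo \<open>I\<close>-power \<open>n\<close> containing it.
\<close>

definition adic_completion :: "'a::comm_ring_1 set \<Rightarrow> (nat \<Rightarrow> 'a set) set" where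
  "adic_completion I =
     {X. (\<forall>n. X n \<in> residue_ring (ideal_power I n)) \<and> (\<forall>n. X (Suc n) \<subseteq> X n)}"

definition completion_zero :: "'a::comm_ring_1 set \<Rightarrow> nat \<Rightarrow> 'a set" where
  "completion_zero I = (\<lambda>n. residue_class (ideal_power I n) 0)"

definition completion_one :: "'a::comm_ring_1 set \<Rightarrow> nat \<Rightarrow> 'a set" where
  "completion_one I = (\<lambda>n. residue_class (ideal_power I n) 1)"

definition completion_mult ::
    "'a::comm_ring_1 set \<Rightarrow> (nat \<Rightarrow> 'a set) \<Rightarrow> (nat \<Rightarrow> 'a set) \<Rightarrow> nat \<Rightarrow> 'a set" where
  "completion_mult I X Y = (\<lambda>n. residue_mult (ideal_power I n) (X n) (Y n))"

primrec completion_power ::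
    "'a::comm_ring_1 set \<Rightarrow> (nat \<Rightarrow> 'a set) \<Rightarrow> nat \<Rightarrow> nat \<Rightarrow> 'a set" where
  "completion_power I X 0 = completion_one I"
| "completion_power I X (Suc k) = completion_mult I X (completion_power I X k)"

definition analytically_unramified :: "'a::comm_ring_1 set \<Rightarrow> bool" where
  "analytically_unramified m \<longleftrightarrow> (\<forall>X \<in> adic_completion m. \<forall>k.
     completion_power m X k = completion_zero m \<longrightarrow> X = completion_zero m)"


section \<open>Length, multiplicity, embedding dimension\<close>

text \<open>
  The length of the quotient module \<open>M/N\<close>, where \<open>N \<subseteq> M\<close> are submodules: chains of submodules of
  \<open>M/N\<close> are chains of submodules between \<open>N\<close> and \<open>M\<close>.
\<close>

definition quotient_length ::
    "('a::comm_ring_1 \<Rightarrow> 'b::ab_group_add \<Rightarrow> 'b) \<Rightarrow> 'b set \<Rightarrow> 'b set \<Rightarrow> enat" where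
  "quotient_length scale M N = Sup {enat n | n. \<exists>C :: nat \<Rightarrow> 'b set.
     N \<subseteq> C 0 \<and> C n \<subseteq> M \<and> (\<forall>i\<le>n. module.subspace scale (C i)) \<and> (\<forall>i<n. C i \<subset> C (Suc i))}"

abbreviation residue_length :: "'a::comm_ring_1 set \<Rightarrow> enat" where
  "residue_length I \<equiv> quotient_length (*) UNIV I"

text \<open>
  Hilbert-Samuel multiplicity on \<open>R\<close> of an ideal \<open>I\<close> primary to the maximal ideal of a Noetherian
  local ring. In this situation the dimension and all lengths involved are finite.
\<close>

definition hilbert_samuel_multiplicity :: "'a::comm_ring_1 set \<Rightarrow> real" where
  "hilbert_samuel_multiplicity I = (let d = the_enat (krull_dim TYPE('a)) in
     lim (\<lambda>n. fact d * real (the_enat (residue_length (ideal_power I n))) / real n ^ d))"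

text \<open>
  \<open>B\<close> represents a basis of \<open>m/m\<^sup>2\<close> over the field \<open>R/m\<close>. Linear independence forces the
  elements of \<open>B\<close> to have distinct classes, so \<open>card B\<close> is the cardinality of that basis. The
  embedding dimension then follows the library's definition of the dimension of a vector space.
\<close>

definition cotangent_basis :: "'a::comm_ring_1 set \<Rightarrow> 'a set \<Rightarrow> bool" where
  "cotangent_basis m B \<longleftrightarrow> B \<subseteq> m \<and>
     (\<forall>F r. finite F \<longrightarrow> F \<subseteq> B \<longrightarrow> (\<Sum>b\<in>F. r b * b) \<in> ideal_power m 2 \<longrightarrow> (\<forall>b\<in>F. r b \<in> m)) \<and>
     (\<forall>x\<in>m. \<exists>F r. finite F \<and> F \<subseteq> B \<and> x - (\<Sum>b\<in>F. r b * b) \<in> ideal_power m 2)"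

definition embedding_dim :: "'a::comm_ring_1 set \<Rightarrow> nat" where
  "embedding_dim m = card (SOME B. cotangent_basis m B)"


section \<open>Fractional ideals\<close>

definition scale_tfrac :: "'a::comm_ring_1 \<Rightarrow> 'a tfrac \<Rightarrow> 'a tfrac" where
  "scale_tfrac r z = of_ring r * z"

lemma module_tfrac: "module (scale_tfrac :: 'a::comm_ring_1 \<Rightarrow> 'a tfrac \<Rightarrow> 'a tfrac)"
  by unfold_locales (simp_all add: scale_tfrac_def algebra_simps of_ring_add of_ring_mult)

definition colon :: "'a::comm_ring_1 tfrac set \<Rightarrow> 'a tfrac set \<Rightarrow> 'a tfrac set" where
  "colon I J = {z. \<forall>y\<in>J. z * y \<in> I}"

definition fractional_ideal :: "'a::comm_ring_1 tfrac set \<Rightarrow> bool" where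
  "fractional_ideal J \<longleftrightarrow> module.subspace scale_tfrac J \<and> (\<exists>B. finite B \<and> J = module.span scale_tfrac B) \<and>
     (\<exists>z\<in>J. non_zero_divisor z)"

definition integral_closure :: "'a::comm_ring_1 tfrac set" where
  "integral_closure = {z. \<exists>p :: 'a poly. lead_coeff p = 1 \<and> poly (map_poly of_ring p) z = 0}"

text \<open>The conductor is contained in \<open>R\<close> because \<open>1\<close> is integral; it is regarded as an ideal of \<open>R\<close>.\<close>

definition conductor :: "'a::comm_ring_1 set" where
  "conductor = of_ring -` colon (range of_ring) integral_closure"

definition canonical_ideal :: "'a::comm_ring_1 tfrac set \<Rightarrow> bool" where
  "canonical_ideal \<omega> \<longleftrightarrow> fractional_ideal \<omega> \<and>
     (\<forall>J. fractional_ideal J \<longrightarrow> colon \<omega> (colon \<omega> J) = J)"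

text \<open>
  A canonical ideal between \<open>R\<close> and its integral closure exists, and the inclusion does not depend
  on its choice, for the one-dimensional rings to which this notion is applied.
\<close>

definition almost_gorenstein :: "'a::comm_ring_1 set \<Rightarrow> bool" where
  "almost_gorenstein m \<longleftrightarrow> (\<exists>\<omega>. canonical_ideal \<omega> \<and> range of_ring \<subseteq> \<omega> \<and>
     \<omega> \<subseteq> integral_closure \<and> \<omega> \<subseteq> colon (of_ring ` m) (of_ring ` m))"

end

theory Submission
  imports Defs "HOL-Library.Set_Algebras"
begin

text \<open>
  Let \<open>S\<close> be the integral closure, \<open>c\<close> the conductor and \<open>n = \<ell>(R/c)\<close>. As the residue field is infinite,
  \<open>m\<close> and \<open>c\<close> have principal reductions: \<open>mS = xS\<close> and \<open>c = tS\<close>. The latter gives \<open>e(c) = \<ell>(S/c)\<close>, and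
  the former \<open>cm \<subseteq> xc\<close>, so that \<open>c \<subseteq> x\<inverse>c \<subseteq> m : m \<subseteq> S\<close>.

  Dualizing into the canonical ideal yields \<open>\<ell>(S/\<omega>) \<le> n\<close>. Since \<open>x\<inverse>c\<close> is an \<open>S\<close>-module not contained in
  \<open>c = \<omega> : S\<close>, it is not contained in \<open>\<omega>\<close>; hence \<open>\<omega>\<close> is a proper submodule of \<open>m : m\<close> and
  \<open>\<ell>(S/(m : m)) \<le> n - 1\<close>. The remaining part is bounded by
  \<open>\<ell>((m : m)/x\<inverse>c) + \<ell>(x\<inverse>c/c) = \<ell>(x(m : m)/c) + \<ell>(R/xR) \<le> (\<nu> - 1) n + 1\<close>.
  For this, extend \<open>x\<close> to \<open>\<nu>\<close> generators of \<open>m\<close>. The ideal \<open>xR + c\<close> annihilates \<open>m/xR\<close>, which gives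
  \<open>\<ell>(R/xR) \<le> 1 + (\<nu> - 1) \<ell>(R/(xR + c))\<close>. The ideal \<open>c : x\<close> annihilates \<open>m/c\<close>, so adjoining
  the generators one by one to \<open>c\<close> bounds \<open>\<ell>(x(m : m)/c)\<close> by \<open>(\<nu> - 1) \<ell>(R/(c : x))\<close>; and the two lengths
  \<open>\<ell>(R/(xR + c))\<close> and \<open>\<ell>(R/(c : x))\<close> add up to \<open>n\<close>.
\<close>

section \<open>Length of quotient modules\<close>

text \<open>The count leaves no room: the summand 1 in \<open>\<ell>(R/xR)\<close> is the length of
  \<open>R/m\<close>, and it is cancelled by the unit that properness of \<open>\<omega>\<close> in
  \<open>m : m\<close> saves. A naive count for \<open>D = x(m : m)\<close> is therefore too weak:
  adjoining all \<open>\<nu>\<close> generators of \<open>m\<close> to \<open>c\<close> gives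
  \<open>\<ell>(R/c) \<le> \<nu> a + 1\<close> with \<open>a = \<ell>(R/(c : x))\<close>, one
  generator and one unit too many. The generator is saved by passing to
  \<open>\<ell>(D/c) = \<ell>(R/c) - \<ell>(R/D)\<close>: as \<open>Dm \<subseteq> xR\<close>, the
  step that adjoins a further generator \<open>y\<close> to \<open>xR + c\<close> is at most as long
  as \<open>R/D\<close>. The unit is saved by the equality case: if no step loses length, the
  relations among the generators force \<open>c \<subseteq> xR\<close>, that is
  \<open>x\<inverse>c \<subseteq> R \<subseteq> \<omega>\<close>, which is excluded. The inclusion
  \<open>cm \<subseteq> xc\<close> holds because \<open>ry = x (r (y/x))\<close>, where
  \<open>y/x\<close> lies in \<open>S\<close> and \<open>c\<close> is an ideal of \<open>S\<close>.
  That \<open>x\<close> extends to \<open>\<nu>\<close> generators of \<open>m\<close> has a similar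
  reason: \<open>x\<close> in the square of \<open>m\<close> would put \<open>1/x\<close> into
  \<open>S\<close>, whence \<open>c = xc\<close>.\<close>

lemma enat_add_le:
  assumes "\<And>i j. enat i \<le> a \<Longrightarrow> enat j \<le> b \<Longrightarrow> enat (i + j) \<le> c"
  shows "a + b \<le> c"
proof (cases c)
  case (enat k)
  have b0: "enat i \<le> a \<Longrightarrow> i \<le> k" for i
    using assms[of i 0] enat by (simp add: zero_enat_def[symmetric])
  have a0: "enat j \<le> b \<Longrightarrow> j \<le> k" for j
    using assms[of 0 j] enat by (simp add: zero_enat_def[symmetric])
  obtain i where i: "a = enat i" using b0[of "Suc k"] by (cases a) auto
  obtain j where j: "b = enat j" using a0[of "Suc k"] by (cases b) auto
  show ?thesis using assms[of i j] i j by simp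
qed simp

lemma set_plus_subset_iff:
  fixes A B C :: "'a::ab_group_add set"
  shows "A + B \<subseteq> C \<longleftrightarrow> (\<forall>a\<in>A. \<forall>b\<in>B. a + b \<in> C)"
  by (auto simp: set_plus_def)

text \<open>The condition from \<open>quotient_length\<close> as a predicate. \<open>C\<close> is
  unconstrained beyond the index \<open>n\<close>, so a chain is truncated by keeping the same
  function with a smaller \<open>n\<close>.\<close>

definition submodule_chain ::
    "('a::comm_ring_1 \<Rightarrow> 'b::ab_group_add \<Rightarrow> 'b) \<Rightarrow> 'b set \<Rightarrow> 'b set \<Rightarrow> nat \<Rightarrow> (nat \<Rightarrow> 'b set) \<Rightarrow> bool" where
  "submodule_chain scale M N n C \<longleftrightarrow> N \<subseteq> C 0 \<and> C n \<subseteq> M \<and> (\<forall>i\<le>n. module.subspace scale (C i)) \<and>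
     (\<forall>i<n. C i \<subset> C (Suc i))"

context
  fixes scale :: "'a::comm_ring_1 \<Rightarrow> 'b::ab_group_add \<Rightarrow> 'b"
  assumes module_scale: "module scale"
begin

interpretation M: module scale
  by (rule module_scale)

lemma subspace_set_plus: "M.subspace A \<Longrightarrow> M.subspace B \<Longrightarrow> M.subspace (A + B)"
proof -
  assume A: "M.subspace A" and B: "M.subspace B"
  show "M.subspace (A + B)"
  proof (rule M.subspaceI)
    show "0 \<in> A + B" using set_plus_intro[OF M.subspace_0[OF A] M.subspace_0[OF B]] by simp
  next
    fix x y assume "x \<in> A + B" "y \<in> A + B"
    then obtain a b a' b' where "x = a + b" "y = a' + b'" "a \<in> A" "a' \<in> A" "b \<in> B" "b' \<in> B"
      by (auto elim!: set_plus_elim)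
    moreover have "(a + b) + (a' + b') = (a + a') + (b + b')" by simp
    ultimately show "x + y \<in> A + B"
      using M.subspace_add[OF A] M.subspace_add[OF B] by (metis set_plus_intro)
  next
    fix r x assume "x \<in> A + B"
    then obtain a b where "x = a + b" "a \<in> A" "b \<in> B"
      by (rule set_plus_elim)
    then show "scale r x \<in> A + B"
      using set_plus_intro[OF M.subspace_scale[OF A] M.subspace_scale[OF B]]
      by (simp add: M.scale_right_distrib)
  qed
qed

lemma subset_set_plus_left: "M.subspace B \<Longrightarrow> A \<subseteq> A + B"
  using set_plus_intro[of _ A 0 B] M.subspace_0 by fastforce

lemma subset_set_plus_right: "M.subspace A \<Longrightarrow> B \<subseteq> A + B"
  using set_plus_intro[of 0 A _ B] M.subspace_0 by fastforce

lemma set_plus_least: "M.subspace C \<Longrightarrow> A \<subseteq> C \<Longrightarrow> B \<subseteq> C \<Longrightarrow> A + B \<subseteq> C"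
  unfolding set_plus_subset_iff using M.subspace_add by blast


lemma quotient_length_eq:
  "quotient_length scale M N = Sup {enat n | n. \<exists>C. submodule_chain scale M N n C}"
  by (simp add: quotient_length_def submodule_chain_def)

lemma quotient_length_ge: "submodule_chain scale M N n C \<Longrightarrow> enat n \<le> quotient_length scale M N"
  unfolding quotient_length_eq by (rule Sup_upper) blast

lemma quotient_length_le:
  assumes "\<And>n C. submodule_chain scale M N n C \<Longrightarrow> enat n \<le> l"
  shows "quotient_length scale M N \<le> l"
  unfolding quotient_length_eq by (rule Sup_least) (use assms in blast)

text \<open>A supremum in \<open>enat\<close> need not be attained, but a finite \<open>k\<close>
  below it is: a chain with more than \<open>k - 1\<close> steps is cut off after \<open>k\<close>
  of them. For \<open>k = 0\<close> the supremum yields no chain, and \<open>L\<close> serves as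
  one.\<close>

lemma submodule_chain_exists:
  assumes "M.subspace L" "N \<subseteq> L" "L \<subseteq> M" "enat k \<le> quotient_length scale M N"
  shows "\<exists>C. submodule_chain scale M N k C"
proof (cases k)
  case 0
  show ?thesis
    by (rule exI[of _ "\<lambda>_. L"]) (use assms 0 in \<open>simp add: submodule_chain_def\<close>)
next
  case (Suc j)
  have "enat j < enat k" using Suc by simp
  also note assms(4)
  finally obtain n C where n: "enat j < enat n" and C: "submodule_chain scale M N n C"
    unfolding quotient_length_eq less_Sup_iff by blast
  have kn: "k \<le> n" using n Suc by simp
  have "C k \<subseteq> C n" using kn
  proof (induction n rule: dec_induct)
    case base then show ?case by simp
  next
    case (step i)
    then have "C i \<subset> C (Suc i)" using C by (simp add: submodule_chain_def)
    then show ?case using step by auto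
  qed
  then have "submodule_chain scale M N k C"
    using C kn unfolding submodule_chain_def by auto
  then show ?thesis by blast
qed

lemma chain_mono:
  assumes "submodule_chain scale M N n C" "i \<le> j" "j \<le> n"
  shows "C i \<subseteq> C j"
  using assms(2,3)
proof (induction j rule: dec_induct)
  case (step k)
  then have "C k \<subset> C (Suc k)" using assms(1) by (simp add: submodule_chain_def)
  then show ?case using step by auto
qed simp

text \<open>Repetitions are deleted from the chain. The induction also records that the strict chain
  ends at \<open>C n\<close>, so that a further strict step can be appended.\<close>

lemma weak_chain_length:
  assumes "\<And>i. i \<le> n \<Longrightarrow> M.subspace (C i)" "\<And>i. i < n \<Longrightarrow> C i \<subseteq> C (Suc i)" "N \<subseteq> C 0" "C n \<subseteq> M"
  shows "enat (card {i. i < n \<and> C i \<noteq> C (Suc i)}) \<le> quotient_length scale M N"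
proof -
  have "\<exists>D. submodule_chain scale (C n) (C 0) (card {i. i < n \<and> C i \<noteq> C (Suc i)}) D \<and>
      D (card {i. i < n \<and> C i \<noteq> C (Suc i)}) = C n"
    using assms(1,2)
  proof (induction n)
    case 0
    then show ?case by (intro exI[of _ C]) (simp add: submodule_chain_def)
  next
    case (Suc n)
    define p where "p = card {i. i < n \<and> C i \<noteq> C (Suc i)}"
    obtain D where D: "submodule_chain scale (C n) (C 0) p D" "D p = C n"
      using Suc.IH Suc.prems unfolding p_def by force
    have sub: "C n \<subseteq> C (Suc n)" "M.subspace (C (Suc n))" using Suc.prems by auto
    show ?case
    proof (cases "C n = C (Suc n)")
      case True
      then have "{i. i < Suc n \<and> C i \<noteq> C (Suc i)} = {i. i < n \<and> C i \<noteq> C (Suc i)}"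
        by (auto simp: less_Suc_eq)
      then show ?thesis using D True p_def by auto
    next
      case False
      then have "{i. i < Suc n \<and> C i \<noteq> C (Suc i)} = insert n {i. i < n \<and> C i \<noteq> C (Suc i)}"
        by (auto simp: less_Suc_eq)
      then have c: "card {i. i < Suc n \<and> C i \<noteq> C (Suc i)} = Suc p" by (simp add: p_def)
      have "submodule_chain scale (C (Suc n)) (C 0) (Suc p) (D(Suc p := C (Suc n)))"
        using D False sub unfolding submodule_chain_def
        by (auto simp: less_Suc_eq le_Suc_eq)
      moreover have "(D(Suc p := C (Suc n))) (Suc p) = C (Suc n)" by simp
      ultimately show ?thesis unfolding c by blast
    qed
  qed
  then obtain D where "submodule_chain scale (C n) (C 0) (card {i. i < n \<and> C i \<noteq> C (Suc i)}) D" by blast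
  then have "submodule_chain scale M N (card {i. i < n \<and> C i \<noteq> C (Suc i)}) D"
    using assms(3,4) unfolding submodule_chain_def by blast
  then show ?thesis by (rule quotient_length_ge)
qed

text \<open>For \<open>b = a + l\<close> the difference \<open>l = b - a\<close> lies in
  \<open>B \<inter> L = A \<inter> L\<close>. In contraposed form: a strict inclusion stays visible
  in the trace on \<open>L\<close> or in the image modulo \<open>L\<close>.\<close>

lemma submodule_modular:
  assumes "M.subspace A" "M.subspace B" "M.subspace L" "A \<subseteq> B" "A \<inter> L = B \<inter> L" "A + L = B + L"
  shows "A = B"
proof
  show "B \<subseteq> A"
  proof
    fix b assume b: "b \<in> B"
    then have "b \<in> A + L" using subset_set_plus_left[OF assms(3), of B] assms(6) by blast
    then obtain a l where al: "b = a + l" "a \<in> A" "l \<in> L" by (auto elim: set_plus_elim)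
    then have "l = b - a" by simp
    then have "l \<in> B" using M.subspace_diff[OF assms(2), of b a] b al(2) assms(4) by auto
    then have "l \<in> A" using al assms(5) by blast
    then show "b \<in> A" using al M.subspace_add[OF assms(1)] by blast
  qed
qed fact

lemma quotient_length_add:
  assumes L: "M.subspace L" "N \<subseteq> L" "L \<subseteq> M" and M: "M.subspace M"
  shows "quotient_length scale M N = quotient_length scale M L + quotient_length scale L N"
proof (rule antisym)
  show "quotient_length scale M N \<le> quotient_length scale M L + quotient_length scale L N"
  proof (rule quotient_length_le)
    fix n C assume C: "submodule_chain scale M N n C"
    have sC: "M.subspace (C i)" if "i \<le> n" for i using C that by (simp add: submodule_chain_def)
    have iC: "C i \<subset> C (Suc i)" if "i < n" for i using C that by (simp add: submodule_chain_def)
    have 1: "enat (card {i. i < n \<and> C i \<inter> L \<noteq> C (Suc i) \<inter> L}) \<le> quotient_length scale L N"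
      by (rule weak_chain_length[of n "\<lambda>i. C i \<inter> L"])
        (use sC iC C L in \<open>auto simp: submodule_chain_def intro: M.subspace_inter\<close>)
    have 2: "enat (card {i. i < n \<and> C i + L \<noteq> C (Suc i) + L}) \<le> quotient_length scale M L"
    proof (rule weak_chain_length[of n "\<lambda>i. C i + L"])
      show "C n + L \<subseteq> M"
        using C L M by (intro set_plus_least) (auto simp: submodule_chain_def)
      show "L \<subseteq> C 0 + L" by (rule subset_set_plus_right) (simp add: sC)
      show "C i + L \<subseteq> C (Suc i) + L" if "i < n" for i
        by (rule set_plus_mono2) (use iC that in auto)
    qed (use sC L in \<open>auto intro: subspace_set_plus\<close>)
    have "{..<n} \<subseteq> {i. i < n \<and> C i \<inter> L \<noteq> C (Suc i) \<inter> L} \<union> {i. i < n \<and> C i + L \<noteq> C (Suc i) + L}"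
    proof
      fix i assume i: "i \<in> {..<n}"
      show "i \<in> {i. i < n \<and> C i \<inter> L \<noteq> C (Suc i) \<inter> L} \<union> {i. i < n \<and> C i + L \<noteq> C (Suc i) + L}"
      proof (rule ccontr)
        assume "\<not> ?thesis"
        then have "C i \<inter> L = C (Suc i) \<inter> L" "C i + L = C (Suc i) + L" using i by auto
        from submodule_modular[OF _ _ L(1) _ this] show False using i sC[of i] sC[of "Suc i"] iC[of i] by auto
      qed
    qed
    then have "card {..<n} \<le> card {i. i < n \<and> C i \<inter> L \<noteq> C (Suc i) \<inter> L} +
        card {i. i < n \<and> C i + L \<noteq> C (Suc i) + L}"
      by (intro order_trans[OF card_mono card_Un_le]) auto
    then have "enat n \<le> enat (card {i. i < n \<and> C i + L \<noteq> C (Suc i) + L}) +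
        enat (card {i. i < n \<and> C i \<inter> L \<noteq> C (Suc i) \<inter> L})"
      by (simp add: add.commute)
    also have "\<dots> \<le> quotient_length scale M L + quotient_length scale L N"
      by (rule add_mono[OF 2 1])
    finally show "enat n \<le> quotient_length scale M L + quotient_length scale L N" .
  qed
next
  show "quotient_length scale M L + quotient_length scale L N \<le> quotient_length scale M N"
  proof (rule enat_add_le)
    fix i j assume i: "enat i \<le> quotient_length scale M L" and j: "enat j \<le> quotient_length scale L N"
    obtain C where C: "submodule_chain scale M L i C" using submodule_chain_exists[OF L(1) _ L(3) i] by blast
    obtain D where D: "submodule_chain scale L N j D" using submodule_chain_exists[OF L(1,2) _ j] by blast
    have DL: "D k \<subseteq> L" if "k \<le> j" for k
      using chain_mono[OF D that] D by (auto simp: submodule_chain_def)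
    show "enat (i + j) \<le> quotient_length scale M N"
    proof (cases i)
      case 0
      have "submodule_chain scale M N j D" using D L by (auto simp: submodule_chain_def)
      then show ?thesis using 0 by (simp add: quotient_length_ge)
    next
      case (Suc i')
      \<comment> \<open>\<open>C 0\<close> is dropped at the seam, since only
        \<open>D j \<subseteq> L \<subseteq> C 0 \<subset> C 1\<close> is known to be strict. This
        needs a first step of \<open>C\<close>, whence the separate case
        \<open>i = 0\<close>.\<close>
      define W where "W k = (if k \<le> j then D k else C (k - j))" for k
      have "submodule_chain scale M N (i + j) W"
        unfolding submodule_chain_def
      proof (intro conjI allI impI)
        show "N \<subseteq> W 0" using D by (simp add: W_def submodule_chain_def)
        show "W (i + j) \<subseteq> M" using C Suc by (simp add: W_def submodule_chain_def)
        fix k assume k: "k \<le> i + j"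
        show "M.subspace (W k)" using C D k by (auto simp: W_def submodule_chain_def)
      next
        fix k assume k: "k < i + j"
        consider "k < j" | "k = j" | "j < k" by linarith
        then show "W k \<subset> W (Suc k)"
        proof cases
          case 1 then show ?thesis using D by (simp add: W_def submodule_chain_def)
        next
          case 2
          have "D j \<subseteq> C 0" using C D by (auto simp: submodule_chain_def)
          also have "C 0 \<subset> C (Suc 0)" using C Suc by (simp add: submodule_chain_def)
          finally show ?thesis using 2 by (simp add: W_def)
        next
          case 3
          then have "C (k - j) \<subset> C (Suc (k - j))" using C k by (simp add: submodule_chain_def)
          then show ?thesis using 3 by (simp add: W_def Suc_diff_le)
        qed
      qed
      then show ?thesis by (rule quotient_length_ge)
    qed
  qed
qed

lemma quotient_length_pos:
  assumes "M.subspace M" "M.subspace N" "N \<subset> M"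
  shows "1 \<le> quotient_length scale M N"
proof -
  have "submodule_chain scale M N 1 (\<lambda>i. if i = 0 then N else M)"
    using assms by (auto simp: submodule_chain_def)
  then show ?thesis using quotient_length_ge by (metis one_enat_def)
qed

lemma quotient_length_self: "quotient_length scale M M = 0"
proof -
  have "quotient_length scale M M \<le> 0"
  proof (rule quotient_length_le)
    fix n C assume C: "submodule_chain scale M M n C"
    show "enat n \<le> 0"
    proof (rule ccontr)
      assume "\<not> enat n \<le> 0"
      then have n: "0 < n" by (simp add: zero_enat_def)
      then have "C 0 \<subset> C (Suc 0)" "C (Suc 0) \<subseteq> C n" "M \<subseteq> C 0" "C n \<subseteq> M"
        using C chain_mono[OF C, of "Suc 0" n] by (auto simp: submodule_chain_def)
      then show False by blast
    qed
  qed
  then show ?thesis by simp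
qed

end

lemma module_hom_vimage_subspace:
  assumes "module_hom s1 s2 f" "module.subspace s1 M" "module.subspace s2 K"
  shows "module.subspace s1 {v \<in> M. f v \<in> K}"
proof -
  interpret module_hom s1 s2 f by fact
  show ?thesis
    using m1.subspace_inter[OF assms(2) subspace_vimage[OF assms(3)]]
    by (simp add: Int_def vimage_def)
qed

text \<open>The isomorphism theorem, carried out on chains instead of quotient modules: preimage,
  and image plus \<open>K\<close>, are mutually inverse between the two intervals of submodules.
  Every later isomorphism of quotients is an instance, with \<open>f\<close> a multiplication or the
  embedding \<open>of_ring\<close>.\<close>

lemma quotient_length_image:
  assumes f: "module_hom s1 s2 f" and M: "module.subspace s1 M" and K: "module.subspace s2 K"
  shows "quotient_length s2 (f ` M + K) K = quotient_length s1 M {v \<in> M. f v \<in> K}"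
proof -
  interpret module_hom s1 s2 f by fact
  have img: "m2.subspace (f ` C + K)" if "m1.subspace C" for C
    by (intro subspace_set_plus[OF m2.module_axioms] subspace_image that K)
  show ?thesis
  proof (rule antisym)
    show "quotient_length s2 (f ` M + K) K \<le> quotient_length s1 M {v \<in> M. f v \<in> K}"
    proof (rule quotient_length_le[OF m2.module_axioms])
      fix n C assume C: "submodule_chain s2 (f ` M + K) K n C"
      have sub: "K \<subseteq> C i" "C i \<subseteq> f ` M + K" "m2.subspace (C i)" if "i \<le> n" for i
        using C chain_mono[OF m2.module_axioms C, of 0 i] chain_mono[OF m2.module_axioms C, of i n] that
        by (auto simp: submodule_chain_def)
      have rec: "C i = f ` {v \<in> M. f v \<in> C i} + K" if i: "i \<le> n" for i
      proof
        show "C i \<subseteq> f ` {v \<in> M. f v \<in> C i} + K"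
        proof
          fix z assume z: "z \<in> C i"
          then obtain v k where vk: "z = f v + k" "v \<in> M" "k \<in> K"
            using sub(2)[OF i] by (auto elim!: set_plus_elim)
          have "z - k \<in> C i" using m2.subspace_diff[OF sub(3)[OF i] z] vk sub(1)[OF i] by blast
          then have "f v \<in> C i" using vk by simp
          then show "z \<in> f ` {v \<in> M. f v \<in> C i} + K" using vk by (auto intro: set_plus_intro)
        qed
      qed (intro set_plus_least[OF m2.module_axioms] sub i; blast)
      have "submodule_chain s1 M {v \<in> M. f v \<in> K} n (\<lambda>i. {v \<in> M. f v \<in> C i})"
        unfolding submodule_chain_def
      proof (intro conjI allI impI)
        fix i assume i: "i < n"
        have "{v \<in> M. f v \<in> C i} \<noteq> {v \<in> M. f v \<in> C (Suc i)}"
          using rec[of i] rec[of "Suc i"] C i unfolding submodule_chain_def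
          by (metis Suc_leI less_imp_le psubset_eq)
        then show "{v \<in> M. f v \<in> C i} \<subset> {v \<in> M. f v \<in> C (Suc i)}"
          using C i by (auto simp: submodule_chain_def)
      qed (use sub module_hom_vimage_subspace[OF f M] in auto)
      then show "enat n \<le> quotient_length s1 M {v \<in> M. f v \<in> K}" by (rule quotient_length_ge[OF m1.module_axioms])
    qed
  next
    show "quotient_length s1 M {v \<in> M. f v \<in> K} \<le> quotient_length s2 (f ` M + K) K"
    proof (rule quotient_length_le[OF m1.module_axioms])
      fix n C assume C: "submodule_chain s1 M {v \<in> M. f v \<in> K} n C"
      have sub: "{v \<in> M. f v \<in> K} \<subseteq> C i" "C i \<subseteq> M" "m1.subspace (C i)" if "i \<le> n" for i
        using C chain_mono[OF m1.module_axioms C, of 0 i] chain_mono[OF m1.module_axioms C, of i n] that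
        by (auto simp: submodule_chain_def)
      have rec: "C i = {v \<in> M. f v \<in> f ` C i + K}" if i: "i \<le> n" for i
      proof
        show "C i \<subseteq> {v \<in> M. f v \<in> f ` C i + K}"
          using sub(2)[OF i] subset_set_plus_left[OF m2.module_axioms K, of "f ` C i"] by auto
        show "{v \<in> M. f v \<in> f ` C i + K} \<subseteq> C i"
        proof
          fix v assume v: "v \<in> {v \<in> M. f v \<in> f ` C i + K}"
          then obtain u k where uk: "u \<in> C i" "k \<in> K" "f v = f u + k" by (auto elim!: set_plus_elim)
          have "f (v - u) \<in> K" using uk by (simp add: diff)
          moreover have "v - u \<in> M" using v uk sub(2)[OF i] m1.subspace_diff[OF M] by blast
          ultimately have "v - u \<in> C i" using sub(1)[OF i] by blast
          from m1.subspace_add[OF sub(3)[OF i] this uk(1)] show "v \<in> C i" by simp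
        qed
      qed
      have "submodule_chain s2 (f ` M + K) K n (\<lambda>i. f ` C i + K)"
        unfolding submodule_chain_def
      proof (intro conjI allI impI)
        show "K \<subseteq> f ` C 0 + K"
          by (rule subset_set_plus_right[OF m2.module_axioms]) (simp add: subspace_image sub)
        show "f ` C n + K \<subseteq> f ` M + K" by (intro set_plus_mono2 image_mono sub) auto
        fix i assume i: "i < n"
        have "f ` C i + K \<noteq> f ` C (Suc i) + K"
          using rec[of i] rec[of "Suc i"] C i unfolding submodule_chain_def
          by (metis Suc_leI less_imp_le psubset_eq)
        moreover have "f ` C i + K \<subseteq> f ` C (Suc i) + K"
          using C i by (intro set_plus_mono2 image_mono) (auto simp: submodule_chain_def)
        ultimately show "f ` C i + K \<subset> f ` C (Suc i) + K" by blast
      qed (use sub img in auto)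
      then show "enat n \<le> quotient_length s2 (f ` M + K) K" by (rule quotient_length_ge[OF m2.module_axioms])
    qed
  qed
qed

section \<open>Ideals of Noetherian local rings\<close>

interpretation R: module "(*) :: 'a::comm_ring_1 \<Rightarrow> 'a \<Rightarrow> 'a"
  by (rule module_ring)

declare R.scale_scale [simp del]

lemma module_hom_mult: "module_hom (*) (*) ((*) (x :: 'a::comm_ring_1))"
  by unfold_locales (simp_all add: algebra_simps)

lemma ideal_image_mult: "ideal I \<Longrightarrow> ideal ((*) (x :: 'a::comm_ring_1) ` I)"
  by (rule module_hom.subspace_image[OF module_hom_mult])

lemma ideal_range_mult: "ideal (range ((*) (x :: 'a::comm_ring_1)))"
  by (rule ideal_image_mult) simp

lemma ideal_mult_left: "ideal I \<Longrightarrow> y \<in> I \<Longrightarrow> x * y \<in> I"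
  by (rule R.subspace_scale)

lemma ideal_mult_right: "ideal I \<Longrightarrow> x \<in> I \<Longrightarrow> x * y \<in> (I :: 'a::comm_ring_1 set)"
  using R.subspace_scale[of I x y] by (simp add: mult.commute)

lemma ideal_vimage_mult: "ideal (K :: 'a::comm_ring_1 set) \<Longrightarrow> ideal {r. x * r \<in> K}"
  using module_hom_vimage_subspace[OF module_hom_mult[of x] R.subspace_UNIV] by simp

lemma quotient_length_mult_image:
  fixes I K :: "'a::comm_ring_1 set"
  assumes "ideal I" "ideal K"
  shows "quotient_length (*) ((*) x ` I + K) K = quotient_length (*) I {v \<in> I. x * v \<in> K}"
  by (rule quotient_length_image[OF module_hom_mult assms])

text \<open>\<open>(xR + K)/K\<close> is cyclic with annihilator \<open>K : x\<close>. Adjoining a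
  generator thus costs the length of a residue ring, which is bounded by means of any ideal inside
  \<open>K : x\<close>.\<close>

lemma quotient_length_cyclic:
  fixes K :: "'a::comm_ring_1 set"
  assumes "ideal K"
  shows "quotient_length (*) (range ((*) x) + K) K = residue_length {r. x * r \<in> K}"
  using quotient_length_mult_image[OF R.subspace_UNIV assms, of x] by simp

lemma quotient_length_mult_nonzerodivisor:
  fixes I K :: "'a::comm_ring_1 set"
  assumes "ideal I" "ideal K" "K \<subseteq> I" "non_zero_divisor x"
  shows "quotient_length (*) ((*) x ` I) ((*) x ` K) = quotient_length (*) I K"
proof -
  have "(*) x ` I + (*) x ` K = (*) x ` I"
  proof
    show "(*) x ` I + (*) x ` K \<subseteq> (*) x ` I"
      using assms by (intro set_plus_least[OF module_ring] ideal_image_mult image_mono) auto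
    show "(*) x ` I \<subseteq> (*) x ` I + (*) x ` K"
      by (intro subset_set_plus_left[OF module_ring] ideal_image_mult assms)
  qed
  moreover have "{v \<in> I. x * v \<in> (*) x ` K} = K"
    using assms(3) non_zero_divisor_cancel[OF assms(4)] by blast
  ultimately show ?thesis
    using quotient_length_mult_image[OF assms(1) ideal_image_mult[OF assms(2)], of x x] by simp
qed

lemma non_zero_divisor_power: "non_zero_divisor x \<Longrightarrow> non_zero_divisor (x ^ n)"
  by (induction n) simp_all

text \<open>Zorn's lemma applies because the union of a chain of ideals has finitely many
  generators, which all lie in one member; that member is the union.\<close>

lemma noetherian_maximal_element:
  assumes noeth: "noetherian TYPE('a::comm_ring_1)" and "A \<in> F" "\<And>I. I \<in> F \<Longrightarrow> ideal (I :: 'a set)"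
  obtains M where "M \<in> F" "\<And>I. I \<in> F \<Longrightarrow> M \<subseteq> I \<Longrightarrow> I = M"
proof -
  have "\<exists>M\<in>F. \<forall>X\<in>F. M \<subseteq> X \<longrightarrow> X = M"
  proof (rule subset_Zorn_nonempty)
    fix C assume C: "C \<noteq> {}" "subset.chain F C"
    have ch: "X \<subseteq> Y \<or> Y \<subseteq> X" if "X \<in> C" "Y \<in> C" for X Y
      using C(2) that unfolding subset_chain_def by blast
    have CF: "C \<subseteq> F" using C(2) unfolding subset_chain_def by (rule conjunct1)
    have idC: "ideal X" if "X \<in> C" for X
      by (rule assms(3)[OF subsetD[OF CF that]])
    have "ideal (\<Union>C)"
    proof (rule R.subspaceI)
      obtain X where X: "X \<in> C" using C(1) by blast
      then show "0 \<in> \<Union>C" using R.subspace_0[OF idC[OF X]] by blast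
    next
      fix x y assume "x \<in> \<Union>C" "y \<in> \<Union>C"
      then obtain X Y where XY: "X \<in> C" "Y \<in> C" "x \<in> X" "y \<in> Y" by blast
      have "\<exists>Z\<in>C. x \<in> Z \<and> y \<in> Z" using ch[OF XY(1,2)] XY by blast
      then obtain Z where Z: "Z \<in> C" "x \<in> Z" "y \<in> Z" by blast
      then show "x + y \<in> \<Union>C" using R.subspace_add[OF idC[OF Z(1)]] by blast
    next
      fix c x assume "x \<in> \<Union>C"
      then obtain X where X: "X \<in> C" "x \<in> X" by blast
      then show "c * x \<in> \<Union>C" using R.subspace_scale[OF idC[OF X(1)]] by blast
    qed
    then obtain B where B: "finite B" "\<Union>C = ideal_generated B"
      using noeth unfolding noetherian_def by blast
    have "B \<subseteq> \<Union>C" unfolding B(2) by (rule R.span_superset)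
    then obtain X where X: "X \<in> C" "B \<subseteq> X"
      using finite_subset_Union_chain[OF B(1) _ C] by blast
    have "\<Union>C \<subseteq> X" unfolding B(2) by (rule R.span_minimal[OF X(2) idC[OF X(1)]])
    then have "\<Union>C = X" using X(1) by (intro antisym Union_upper)
    then show "\<Union>C \<in> F" using subsetD[OF CF X(1)] by simp
  qed (use assms(2) in blast)
  then obtain M where "M \<in> F" "\<forall>X\<in>F. M \<subseteq> X \<longrightarrow> X = M" by blast
  then show thesis by (intro that[of M]) auto
qed

lemma noetherian_local_ringD:
  assumes "noetherian_local_ring (m :: 'a::comm_ring_1 set)"
  shows "noetherian TYPE('a)" "ideal m" "m \<noteq> UNIV" "maximal_ideal m"
  using assms unfolding noetherian_local_ring_def maximal_ideal_def by blast+

lemma proper_ideal_subset_maximal: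
  assumes loc: "noetherian_local_ring (m :: 'a::comm_ring_1 set)" and I: "ideal I" "I \<noteq> UNIV"
  shows "I \<subseteq> m"
proof -
  obtain M where M: "M \<in> {J. ideal J \<and> J \<noteq> UNIV \<and> I \<subseteq> J}"
      "\<And>J. J \<in> {J. ideal J \<and> J \<noteq> UNIV \<and> I \<subseteq> J} \<Longrightarrow> M \<subseteq> J \<Longrightarrow> J = M"
    using noetherian_maximal_element[OF noetherian_local_ringD(1)[OF loc], of I "{J. ideal J \<and> J \<noteq> UNIV \<and> I \<subseteq> J}"] I
    by blast
  have "maximal_ideal M" unfolding maximal_ideal_def using M by blast
  then have "M = m" using loc unfolding noetherian_local_ring_def by blast
  then show ?thesis using M(1) by blast
qed

lemma unit_if_notin_maximal:
  assumes "noetherian_local_ring (m :: 'a::comm_ring_1 set)" "x \<notin> m"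
  obtains y where "x * y = 1"
proof -
  have "x \<in> range ((*) x)" by (rule range_eqI[of _ _ 1]) simp
  then have "range ((*) x) = UNIV"
    using proper_ideal_subset_maximal[OF assms(1) ideal_range_mult] assms(2) by blast
  then have "1 \<in> range ((*) x)" by simp
  then show thesis using that by force
qed

lemma one_notin_proper_ideal: "ideal I \<Longrightarrow> I \<noteq> UNIV \<Longrightarrow> 1 \<notin> (I :: 'a::comm_ring_1 set)"
  using ideal_mult_left[of I 1] by fastforce

lemma one_notin_maximal: "noetherian_local_ring (m :: 'a::comm_ring_1 set) \<Longrightarrow> 1 \<notin> m"
  by (rule one_notin_proper_ideal) (rule noetherian_local_ringD; assumption)+

lemma maximal_prime:
  assumes "noetherian_local_ring (m :: 'a::comm_ring_1 set)"
  shows "prime_ideal m"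
  unfolding prime_ideal_def
proof (intro conjI allI impI)
  fix x y assume xy: "x * y \<in> m"
  show "x \<in> m \<or> y \<in> m"
  proof (rule ccontr)
    assume "\<not> (x \<in> m \<or> y \<in> m)"
    then obtain z where "x * z = 1" and "y \<notin> m" using unit_if_notin_maximal[OF assms] by metis
    then have "y = z * (x * y)" by (metis mult.assoc mult.commute mult.right_neutral)
    then show False using ideal_mult_left[OF noetherian_local_ringD(2)[OF assms] xy] \<open>y \<notin> m\<close> by metis
  qed
qed (rule noetherian_local_ringD[OF assms])+

lemma residue_length_maximal:
  assumes "noetherian_local_ring (m :: 'a::comm_ring_1 set)"
  shows "residue_length m = 1"
proof (rule antisym)
  note [simp] = noetherian_local_ringD(2)[OF assms]
  show "1 \<le> residue_length m"
    using noetherian_local_ringD(3)[OF assms] by (intro quotient_length_pos[OF module_ring]) auto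
  show "residue_length m \<le> 1"
  proof (rule quotient_length_le[OF module_ring])
    fix n C assume C: "submodule_chain (*) UNIV m n C"
    show "enat n \<le> 1"
    proof (rule ccontr)
      assume "\<not> enat n \<le> 1"
      then have n: "2 \<le> n" by (simp add: one_enat_def)
      then have "C 0 \<subset> C (Suc 0)" "C (Suc 0) \<subset> C (Suc (Suc 0))" "ideal (C (Suc 0))" "m \<subseteq> C 0"
        using C by (auto simp: submodule_chain_def)
      then show False
        using noetherian_local_ringD(4)[OF assms] unfolding maximal_ideal_def by blast
    qed
  qed
qed

lemma residue_length_add:
  fixes I J :: "'a::comm_ring_1 set"
  assumes "ideal I" "J \<subseteq> I"
  shows "residue_length J = residue_length I + quotient_length (*) I J"
  using assms by (intro quotient_length_add[OF module_ring]) auto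

lemma quotient_length_maximal:
  assumes "noetherian_local_ring (m :: 'a::comm_ring_1 set)" "J \<subseteq> m"
  shows "residue_length J = 1 + quotient_length (*) m J"
  using residue_length_add[OF noetherian_local_ringD(2)[OF assms(1)] assms(2)]
    residue_length_maximal[OF assms(1)] by simp

text \<open>
  An ideal maximal among those avoiding all \<open>x\<^sup>i s\<close> with \<open>s \<notin> p\<close> is prime and lies strictly below \<open>p\<close>.
\<close>

lemma prime_below_nonzerodivisor:
  fixes p :: "'a::comm_ring_1 set"
  assumes noeth: "noetherian TYPE('a)" and p: "prime_ideal p" and x: "non_zero_divisor x" "x \<in> p"
  obtains q where "prime_ideal q" "q \<subset> p"
proof -
  have ip: "ideal p" and p1: "1 \<notin> p"
    and pp: "\<And>a b. a * b \<in> p \<Longrightarrow> a \<in> p \<or> b \<in> p"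
    using p one_notin_proper_ideal unfolding prime_ideal_def by blast+
  \<comment> \<open>The cases \<open>i = 0\<close> and \<open>s = 1\<close> both matter: an ideal
    disjoint from \<open>T\<close> lies in \<open>p\<close> and misses \<open>x\<close>, so it is
    strictly smaller than \<open>p\<close>.\<close>
  define T where "T = {x ^ i * s | i s. s \<notin> p}"
  have T0: "0 \<notin> T"
  proof
    assume "0 \<in> T"
    then obtain i s where "x ^ i * s = 0" "s \<notin> p" unfolding T_def by auto
    then show False
      using non_zero_divisor_power[OF x(1), of i] R.subspace_0[OF ip] unfolding non_zero_divisor_def by auto
  qed
  have Tm: "s * t \<in> T" if st: "s \<in> T" "t \<in> T" for s t
  proof -
    obtain i s' j t' where "s = x ^ i * s'" "t = x ^ j * t'" "s' \<notin> p" "t' \<notin> p"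
      using st unfolding T_def by blast
    then have "s * t = x ^ (i + j) * (s' * t')" "s' * t' \<notin> p"
      using pp[of s' t'] by (simp add: power_add ac_simps, blast)
    then show ?thesis unfolding T_def by blast
  qed
  have Tp: "s \<in> T" if "s \<notin> p" for s
    using that unfolding T_def by (intro CollectI exI[of _ 0] exI[of _ s]) simp
  have Tx: "x \<in> T"
    using p1 unfolding T_def by (intro CollectI exI[of _ 1]) auto
  have "{0} \<in> {I. ideal I \<and> I \<inter> T = {}}" using T0 by auto
  then obtain q where q: "q \<in> {I. ideal I \<and> I \<inter> T = {}}"
      "\<And>I. I \<in> {I. ideal I \<and> I \<inter> T = {}} \<Longrightarrow> q \<subseteq> I \<Longrightarrow> I = q"
    by (rule noetherian_maximal_element[OF noeth]) auto
  have iq: "ideal q" using q(1) by simp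
  have meets: "\<exists>u v. v \<in> q \<and> a * u + v \<in> T" if a: "a \<notin> q" for a
  proof (rule ccontr)
    assume *: "\<not> ?thesis"
    have "ideal (range ((*) a) + q)" by (intro subspace_set_plus[OF module_ring] ideal_range_mult iq)
    then have "range ((*) a) + q \<in> {I. ideal I \<and> I \<inter> T = {}}"
      using * by (auto elim!: set_plus_elim)
    moreover have "q \<subseteq> range ((*) a) + q"
      by (rule subset_set_plus_right[OF module_ring ideal_range_mult])
    ultimately have "range ((*) a) + q = q" using q(2) by blast
    moreover have "a * 1 + 0 \<in> range ((*) a) + q"
      using R.subspace_0[OF iq] by (intro set_plus_intro rangeI)
    ultimately show False using a by simp
  qed
  have "prime_ideal q"
    unfolding prime_ideal_def
  proof (intro conjI allI impI)
    show "q \<noteq> UNIV" using q(1) Tx by blast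
    fix a b assume ab: "a * b \<in> q"
    show "a \<in> q \<or> b \<in> q"
    proof (rule ccontr)
      assume "\<not> (a \<in> q \<or> b \<in> q)"
      then obtain u v u' v' where uv: "v \<in> q" "a * u + v \<in> T" "v' \<in> q" "b * u' + v' \<in> T"
        using meets by blast
      have "(a * u + v) * (b * u' + v') = (u * u') * (a * b) + ((a * u + v) * v' + (b * u') * v)"
        by (simp add: algebra_simps)
      also have "\<dots> \<in> q" 
        by (intro R.subspace_add[OF iq] ideal_mult_left[OF iq ab] ideal_mult_left[OF iq uv(1)]
            ideal_mult_left[OF iq uv(3)])
      finally show False using Tm[OF uv(2,4)] q(1) by blast
    qed
  qed (rule iq)
  moreover have "q \<subseteq> p" using Tp q(1) by blast
  moreover have "x \<notin> q" using Tx q(1) by blast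
  ultimately show thesis using that x(2) by blast
qed

text \<open>An ideal \<open>p\<close> maximal among those containing \<open>x\<close> with infinite
  colength would be prime: for \<open>ab\<close> in \<open>p\<close> with \<open>a\<close>,
  \<open>b\<close> outside, the ideals \<open>aR + p\<close> and \<open>p : a\<close> are strictly
  larger, and their finite colengths add up to that of \<open>p\<close>. A prime strictly below
  \<open>p\<close>, then \<open>p\<close>, then \<open>m\<close> would be a chain too long for
  dimension one.\<close>

lemma residue_length_finite:
  fixes I :: "'a::comm_ring_1 set"
  assumes loc: "noetherian_local_ring (m :: 'a::comm_ring_1 set)" and dim: "krull_dim TYPE('a) = 1"
    and I: "ideal I" and x: "non_zero_divisor x" "x \<in> I"
  shows "residue_length I \<noteq> \<infinity>"
proof
  note noeth = noetherian_local_ringD(1)[OF loc]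
  assume "residue_length I = \<infinity>"
  then have "I \<in> {I. ideal I \<and> x \<in> I \<and> residue_length I = \<infinity>}" using I x by simp
  then obtain p where p: "p \<in> {I. ideal I \<and> x \<in> I \<and> residue_length I = \<infinity>}"
      and pmax: "\<And>I. I \<in> {I. ideal I \<and> x \<in> I \<and> residue_length I = \<infinity>} \<Longrightarrow> p \<subseteq> I \<Longrightarrow> I = p"
    by (rule noetherian_maximal_element[OF noeth]) auto
  have ip: "ideal p" and xp: "x \<in> p" and lp: "residue_length p = \<infinity>" using p by auto
  have pU: "p \<noteq> UNIV" using lp quotient_length_self[OF module_ring, of "UNIV :: 'a set"] by auto
  have "prime_ideal p"
    unfolding prime_ideal_def
  proof (intro conjI allI impI)
    fix a b assume ab: "a * b \<in> p"
    show "a \<in> p \<or> b \<in> p"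
    proof (rule ccontr)
      assume n: "\<not> (a \<in> p \<or> b \<in> p)"
      let ?A = "range ((*) a) + p" and ?B = "{r. a * r \<in> p}"
      have iA: "ideal ?A" by (intro subspace_set_plus[OF module_ring] ideal_range_mult ip)
      have iB: "ideal ?B" by (rule ideal_vimage_mult[OF ip])
      have pA: "p \<subseteq> ?A" by (rule subset_set_plus_right[OF module_ring ideal_range_mult])
      have pB: "p \<subseteq> ?B" using ideal_mult_left[OF ip] by blast
      have "a * 1 + 0 \<in> ?A" using R.subspace_0[OF ip] by (intro set_plus_intro rangeI)
      then have "?A \<noteq> p" using n by auto
      moreover have "b \<in> ?B" using ab by simp
      then have "?B \<noteq> p" using n by auto
      ultimately have "residue_length ?A \<noteq> \<infinity>" "residue_length ?B \<noteq> \<infinity>"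
        using pmax[of ?A] pmax[of ?B] iA iB pA pB subsetD[OF pA xp] subsetD[OF pB xp] by auto
      moreover have "residue_length p = residue_length ?A + residue_length ?B"
        using residue_length_add[OF iA pA] quotient_length_cyclic[OF ip, of a] by simp
      ultimately show False using lp by (auto simp: plus_eq_infty_iff_enat)
    qed
  qed (use ip pU in auto)
  then obtain q where q: "prime_ideal q" "q \<subset> p"
    using prime_below_nonzerodivisor[OF noeth _ x(1) xp] by blast
  have "p \<noteq> m" using lp residue_length_maximal[OF loc] by auto
  then have pm: "p \<subset> m" using proper_ideal_subset_maximal[OF loc ip pU] by blast
  define P where "P i = (if i = 0 then q else if i = 1 then p else m)" for i :: nat
  have "enat 2 \<le> krull_dim TYPE('a)"
    unfolding krull_dim_def
  proof (rule Sup_upper, intro CollectI exI[of _ 2] conjI exI[of _ P] refl allI impI)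
    fix i :: nat assume "i < 2"
    then show "P i \<subset> P (Suc i)" using q(2) pm by (auto simp: P_def less_2_cases_iff)
  qed (use q(1) \<open>prime_ideal p\<close> maximal_prime[OF loc] in \<open>auto simp: P_def\<close>)
  then show False using dim by (simp add: one_enat_def)
qed

text \<open>The depth is one, hence positive, and the first entry of a regular sequence is regular
  modulo the ideal generated by no elements, which is zero.\<close>

lemma cohen_macaulay_nonzerodivisor:
  assumes "krull_dim TYPE('a::comm_ring_1) = 1" "cohen_macaulay (m :: 'a set)"
  obtains x where "x \<in> m" "non_zero_divisor x"
proof -
  have "0 < depth m" using assms by (simp add: cohen_macaulay_def)
  then obtain xs where xs: "xs \<noteq> []" "set xs \<subseteq> m" "regular_sequence xs"
    unfolding depth_def less_Sup_iff by (auto simp: zero_enat_def)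
  have "\<forall>y. xs ! 0 * y \<in> ideal_generated (set (take 0 xs)) \<longrightarrow> y \<in> ideal_generated (set (take 0 xs))"
    using xs(1,3) unfolding regular_sequence_def by blast
  then have "non_zero_divisor (xs ! 0)" by (simp add: non_zero_divisor_def)
  moreover have "xs ! 0 \<in> m" using xs(1,2) by (auto simp: subset_eq)
  ultimately show thesis using that by blast
qed

section \<open>A length inequality for colon ideals\<close>

lemma ideal_generated_insert:
  "ideal_generated (insert (g :: 'a::comm_ring_1) F) = range ((*) g) + ideal_generated F"
proof -
  have "z \<in> range ((*) g) + ideal_generated F \<longleftrightarrow> (\<exists>k. z - k * g \<in> ideal_generated F)" for z
  proof
    assume "z \<in> range ((*) g) + ideal_generated F"
    then obtain k v where "z = g * k + v" "v \<in> ideal_generated F" by (auto elim!: set_plus_elim)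
    then show "\<exists>k. z - k * g \<in> ideal_generated F" by (intro exI[of _ k]) (simp add: mult.commute)
  next
    assume "\<exists>k. z - k * g \<in> ideal_generated F"
    then obtain k where "z - k * g \<in> ideal_generated F" by blast
    then have "g * k + (z - k * g) \<in> range ((*) g) + ideal_generated F"
      by (intro set_plus_intro rangeI)
    then show "z \<in> range ((*) g) + ideal_generated F" by (simp add: mult.commute)
  qed
  then show ?thesis unfolding R.span_insert by blast
qed

text \<open>Each adjoined generator adds a cyclic quotient whose annihilator contains
  \<open>A\<close>, hence a length of at most \<open>a\<close>. In the equality case all these
  annihilators equal \<open>A\<close>; the coefficient of the last generator in a relation then lies
  in \<open>A\<close>, its term lies in \<open>N\<close> and can be removed. So the quotient is free
  over \<open>R/A\<close> on the classes of \<open>F\<close>.\<close>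

lemma quotient_length_generators:
  fixes N A :: "'a::comm_ring_1 set"
  assumes "finite F" and N: "ideal N" and A: "ideal A" "residue_length A = enat a"
    and AF: "\<And>g r. g \<in> F \<Longrightarrow> r \<in> A \<Longrightarrow> r * g \<in> N"
  shows "\<exists>l\<le>card F * a. quotient_length (*) (N + ideal_generated F) N = enat l \<and>
    (l = card F * a \<longrightarrow> (\<forall>s. (\<Sum>g\<in>F. s g * g) \<in> N \<longrightarrow> (\<forall>g\<in>F. s g \<in> A)))"
  using assms(1) AF
proof (induction F rule: finite_induct)
  case empty
  then show ?case by (simp add: quotient_length_self[OF module_ring] zero_enat_def)
next
  case (insert g F)
  let ?M = "N + ideal_generated F" and ?M' = "N + ideal_generated (insert g F)"
  let ?B = "{r. g * r \<in> ?M}"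
  obtain l where l: "l \<le> card F * a" "quotient_length (*) ?M N = enat l"
    "\<And>s h. l = card F * a \<Longrightarrow> (\<Sum>g\<in>F. s g * g) \<in> N \<Longrightarrow> h \<in> F \<Longrightarrow> s h \<in> A"
    using insert.IH insert.prems by auto
  have iM: "ideal ?M" by (intro subspace_set_plus[OF module_ring] N) simp
  have iB: "ideal ?B" by (rule ideal_vimage_mult[OF iM])
  have NM: "N \<subseteq> ?M" by (rule subset_set_plus_left[OF module_ring]) simp
  have AB: "A \<subseteq> ?B"
  proof
    fix r assume "r \<in> A"
    then have "r * g \<in> ?M" using insert.prems[of g r] NM by blast
    then show "r \<in> ?B" by (simp add: mult.commute)
  qed
  have M': "?M' = range ((*) g) + ?M"
    by (simp add: ideal_generated_insert ac_simps)
  have iM': "ideal ?M'" by (intro subspace_set_plus[OF module_ring] N) simp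
  have MM': "?M \<subseteq> ?M'"
    unfolding M' by (rule subset_set_plus_right[OF module_ring ideal_range_mult])
  have "residue_length A = residue_length ?B + quotient_length (*) ?B A"
    by (rule residue_length_add[OF iB AB])
  then obtain b b' where b: "residue_length ?B = enat b" "quotient_length (*) ?B A = enat b'" "a = b + b'"
    using A(2) by (cases "residue_length ?B"; cases "quotient_length (*) ?B A") auto
  have len: "quotient_length (*) ?M' N = enat (b + l)"
    using quotient_length_add[OF module_ring iM NM MM' iM'] quotient_length_cyclic[OF iM, of g] l(2) b(1)
    by (simp add: M')
  have c: "card (insert g F) = Suc (card F)" using insert.hyps by simp
  show ?case unfolding len c
  proof (intro exI[of _ "b + l"] conjI impI allI refl)
    show "b + l \<le> Suc (card F) * a" using l(1) b(3) by simp
    fix s assume eq: "b + l = Suc (card F) * a" and s: "(\<Sum>h\<in>insert g F. s h * h) \<in> N"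
    have ba: "b' = 0" "l = card F * a" using eq l(1) b(3) by auto
    have BA: "?B = A"
    proof (rule ccontr)
      assume "?B \<noteq> A"
      then have "1 \<le> quotient_length (*) ?B A" using AB by (intro quotient_length_pos[OF module_ring] iB A) auto
      then show False using b(2) ba(1) by (simp add: zero_enat_def[symmetric])
    qed
    have sum: "(\<Sum>h\<in>insert g F. s h * h) = s g * g + (\<Sum>h\<in>F. s h * h)" using insert.hyps by simp
    have "(\<Sum>h\<in>F. s h * h) \<in> ideal_generated F" by (intro R.span_sum R.span_scale R.span_base)
    then have "- (\<Sum>h\<in>F. s h * h) \<in> ideal_generated F" by (rule R.span_neg)
    from set_plus_intro[OF s this] have "g * s g \<in> ?M" using sum by (simp add: mult.commute)
    then have sg: "s g \<in> A" using BA by blast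
    then have "s g * g \<in> N" using insert.prems[of g] by simp
    from R.subspace_diff[OF N s this] have "(\<Sum>h\<in>F. s h * h) \<in> N" using sum by simp
    then show "\<forall>h\<in>insert g F. s h \<in> A" using sg l(3)[OF ba(2)] by auto
  qed
qed

text \<open>The colon ideal below is \<open>x (m : m)\<close>.\<close>

lemma quotient_length_colon_bound:
  fixes m c :: "'a::comm_ring_1 set"
  assumes loc: "noetherian_local_ring m" and x: "x \<in> m" "non_zero_divisor x"
    and G: "finite G" "m = ideal_generated (insert x G)"
    and c: "ideal c" "c \<subseteq> m" "\<And>r y. r \<in> c \<Longrightarrow> y \<in> m \<Longrightarrow> r * y \<in> (*) x ` c" "\<not> c \<subseteq> range ((*) x)"
    and n: "residue_length c = enat n" and e: "residue_length (range ((*) x)) = enat e"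
  shows "\<exists>d. quotient_length (*) {r. \<forall>y\<in>m. r * y \<in> (*) x ` m} c = enat d \<and> d + e \<le> card G * n + 1"
proof -
  define D where "D = {r. \<forall>y\<in>m. r * y \<in> (*) x ` m}"
  define A where "A = {r. x * r \<in> c}"
  define xR where "xR = range ((*) x)"
  define X where "X = xR + c"
  note im = noetherian_local_ringD(2)[OF loc]
  have ixR: "ideal xR" unfolding xR_def by (rule ideal_range_mult)
  have iX: "ideal X" unfolding X_def by (intro subspace_set_plus[OF module_ring] ixR c)
  have iA: "ideal A" unfolding A_def by (rule ideal_vimage_mult[OF c(1)])
  have cA: "c \<subseteq> A" unfolding A_def using ideal_mult_left[OF c(1)] by blast
  have cX: "c \<subseteq> X" unfolding X_def by (rule subset_set_plus_right[OF module_ring ixR])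
  have xX: "xR \<subseteq> X" unfolding X_def by (rule subset_set_plus_left[OF module_ring c(1)])
  have xm: "xR \<subseteq> m" unfolding xR_def using ideal_mult_right[OF im x(1)] by blast
  have xxR: "x * u \<in> xR" for u unfolding xR_def by (rule rangeI)
  have Gm: "G \<subseteq> m" unfolding G(2) using R.span_superset[of "insert x G"] by simp
  \<comment> \<open>Cancelling \<open>x\<close> in \<open>(x r) y \<in> xc\<close> shows that
    \<open>A = c : x\<close> annihilates \<open>m/c\<close>.\<close>
  have Am: "r * y \<in> c" if r: "r \<in> A" and y: "y \<in> m" for r y
  proof -
    have "(x * r) * y \<in> (*) x ` c" using c(3)[of "x * r" y] r y by (simp add: A_def)
    then obtain z where "x * (r * y) = x * z" "z \<in> c" by (auto simp: mult.assoc)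
    then show ?thesis using non_zero_divisor_cancel[OF x(2)] by metis
  qed
  have mG: "m = xR + ideal_generated G" unfolding G(2) xR_def by (rule ideal_generated_insert)
  have "enat n = residue_length X + residue_length A"
    using residue_length_add[OF iX cX] quotient_length_cyclic[OF c(1), of x] n
    by (simp add: X_def xR_def A_def)
  then obtain a b where ab: "residue_length A = enat a" "residue_length X = enat b" "n = b + a"
    by (cases "residue_length A"; cases "residue_length X") auto
  have e_le: "e \<le> card G * b + 1"
  proof -
    \<comment> \<open>\<open>X\<close> annihilates \<open>m/xR\<close>: this is clear on
      \<open>xR\<close>, and on \<open>c\<close> it follows from
      \<open>cm \<subseteq> xc\<close>.\<close>
    have "r * g \<in> xR" if g: "g \<in> G" and r: "r \<in> X" for g r
    proof -
      obtain u v where uv: "r = x * u + v" "v \<in> c"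
        using r unfolding X_def xR_def by (auto elim!: set_plus_elim)
      obtain w where "v * g = x * w" using c(3)[OF uv(2)] g Gm by blast
      then have "r * g = x * (u * g + w)" using uv(1) by (simp add: algebra_simps)
      then show ?thesis using xxR by simp
    qed
    then obtain l where l: "l \<le> card G * b" "quotient_length (*) m xR = enat l"
      using quotient_length_generators[OF G(1) ixR iX ab(2)] mG[symmetric] by auto
    then show ?thesis using quotient_length_maximal[OF loc xm] e by (simp add: one_enat_def xR_def)
  qed
  \<comment> \<open>There is a generator besides \<open>x\<close>, for otherwise
    \<open>m = xR\<close> would contain \<open>c\<close>. One such \<open>y\<close> is set apart
    because its step will be compared with \<open>R/D\<close> instead of \<open>R/A\<close>.\<close>
  have "G \<noteq> {}"
  proof
    assume "G = {}"
    then have "m = xR" using mG by simp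
    then show False using c(2,4) unfolding xR_def by simp
  qed
  then obtain y F where yF: "G = insert y F" "y \<notin> F" by (metis Set.set_insert equals0I)
  have F: "finite F" "card G = Suc (card F)" "F \<subseteq> m" "y \<in> m"
    using yF G(1) Gm by auto
  define N where "N = range ((*) y) + X"
  define B where "B = {r. y * r \<in> X}"
  have iN: "ideal N" unfolding N_def by (intro subspace_set_plus[OF module_ring] ideal_range_mult iX)
  have iB: "ideal B" unfolding B_def by (rule ideal_vimage_mult[OF iX])
  have XN: "X \<subseteq> N" unfolding N_def by (rule subset_set_plus_right[OF module_ring ideal_range_mult])
  have NF: "N + ideal_generated F = m"
  proof
    have "ideal_generated F \<subseteq> m" by (rule R.span_minimal[OF F(3) im])
    moreover have "range ((*) y) \<subseteq> m" using ideal_mult_right[OF im F(4)] by blast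
    ultimately show "N + ideal_generated F \<subseteq> m"
      unfolding N_def X_def using xm c(2) by (intro set_plus_least[OF module_ring] im)
    have "m = (range ((*) y) + xR) + ideal_generated F"
      unfolding mG yF(1) ideal_generated_insert by (simp add: ac_simps)
    also have "\<dots> \<subseteq> N + ideal_generated F" unfolding N_def using xX by (intro set_plus_mono2) auto
    finally show "m \<subseteq> N + ideal_generated F" .
  qed
  have Nm: "N \<subseteq> m" using subset_set_plus_left[OF module_ring, of "ideal_generated F" N] NF by simp
  have "r * g \<in> N" if "g \<in> F" "r \<in> A" for g r
    using Am[OF that(2), of g] that(1) F(3) cX XN by blast
  then obtain p where p: "p \<le> card F * a" "quotient_length (*) m N = enat p"
      "\<And>s g. p = card F * a \<Longrightarrow> (\<Sum>g\<in>F. s g * g) \<in> N \<Longrightarrow> g \<in> F \<Longrightarrow> s g \<in> A"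
    using quotient_length_generators[OF F(1) iN iA ab(1)] unfolding NF by blast
  have iD: "ideal D"
  proof (rule R.subspaceI)
    show "0 \<in> D" using R.subspace_0[OF ideal_image_mult[OF im]] by (simp add: D_def)
  next
    fix r s assume "r \<in> D" "s \<in> D"
    then show "r + s \<in> D"
      using R.subspace_add[OF ideal_image_mult[OF im]] by (simp add: D_def distrib_right)
  next
    fix k r assume "r \<in> D"
    then show "k * r \<in> D"
      using ideal_mult_left[OF ideal_image_mult[OF im]] by (simp add: D_def mult.assoc)
  qed
  have cD: "c \<subseteq> D" unfolding D_def using c(2,3) by blast
  have Dx: "r * g \<in> xR" if "r \<in> D" "g \<in> m" for r g using that unfolding D_def xR_def by auto
  \<comment> \<open>As \<open>Dm \<subseteq> xR \<subseteq> X\<close>, the quotient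
    \<open>N/X\<close>, of length \<open>\<ell>(R/B)\<close>, is at most as long as
    \<open>R/D\<close>; \<open>j\<close> below measures the difference.\<close>
  have DB: "D \<subseteq> B"
  proof
    fix d assume "d \<in> D"
    then have "d * y \<in> X" using Dx F(4) xX by blast
    then show "d \<in> B" by (simp add: B_def mult.commute)
  qed
  have "quotient_length (*) m c = quotient_length (*) m N + (quotient_length (*) N X + quotient_length (*) X c)"
    using quotient_length_add[OF module_ring iN order_trans[OF cX XN] Nm im]
      quotient_length_add[OF module_ring iX cX XN iN] by simp
  then have lN: "residue_length c = 1 + (quotient_length (*) m N + (residue_length B + residue_length A))"
    using quotient_length_maximal[OF loc c(2)] quotient_length_cyclic[OF iX, of y]
      quotient_length_cyclic[OF c(1), of x]
    by (simp add: N_def X_def xR_def A_def B_def)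
  then obtain b' where b': "residue_length B = enat b'" "n = 1 + p + b' + a"
    using n p(2) ab(1) by (cases "residue_length B") (auto simp: one_enat_def)
  have "residue_length c = residue_length D + quotient_length (*) D c"
    by (rule residue_length_add[OF iD cD])
  then obtain q d where qd: "residue_length D = enat q" "quotient_length (*) D c = enat d" "n = q + d"
    using n by (cases "residue_length D"; cases "quotient_length (*) D c") auto
  have "residue_length D = residue_length B + quotient_length (*) B D"
    by (rule residue_length_add[OF iB DB])
  then obtain j where j: "quotient_length (*) B D = enat j" "q = b' + j"
    using qd(1) b'(1) by (cases "quotient_length (*) B D") auto
  \<comment> \<open>If every step of the filtration \<open>c \<subseteq> xR + c \<subseteq> yR + xR + c \<subseteq> \<dots> \<subseteq> m\<close> had the largest
    possible length, then \<open>c\<close> would be contained in \<open>xR\<close>.\<close>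
  have "\<not> (p = card F * a \<and> j = 0)"
  proof
    assume tight: "p = card F * a \<and> j = 0"
    have BD: "B = D"
    proof (rule ccontr)
      assume "B \<noteq> D"
      then have "1 \<le> quotient_length (*) B D"
        using DB by (intro quotient_length_pos[OF module_ring] iB iD) auto
      then show False using j(1) tight by (simp add: zero_enat_def[symmetric])
    qed
    have AD: "A \<subseteq> D"
    proof
      fix r assume "r \<in> A"
      then have "r * y \<in> X" using Am[of r y] F(4) cX by blast
      then show "r \<in> D" using BD by (simp add: B_def mult.commute set_eq_iff)
    qed
    have "c \<subseteq> xR"
    proof
      fix z assume z: "z \<in> c"
      then have "z \<in> xR + (range ((*) y) + ideal_generated F)"
        using c(2) mG unfolding yF(1) ideal_generated_insert by blast
      then obtain u v w where w: "z = x * u + (y * v + w)" "w \<in> ideal_generated F"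
        unfolding xR_def by (auto elim!: set_plus_elim)
      obtain s where s: "w = (\<Sum>g\<in>F. s g * g)" using w(2) unfolding R.span_finite[OF F(1)] by blast
      have "w = y * (- v) + (x * (- u) + z)" using w(1) by simp
      moreover have "y * (- v) + (x * (- u) + z) \<in> N"
        unfolding N_def X_def xR_def using z by (intro set_plus_intro rangeI)
      ultimately have "(\<Sum>g\<in>F. s g * g) \<in> N" using s by simp
      \<comment> \<open>This is the equality case of \<open>quotient_length_generators\<close>. With
        \<open>Am \<subseteq> c\<close> and \<open>A \<subseteq> D\<close> it puts \<open>w\<close>
        into both \<open>c\<close> and \<open>xR\<close>; then \<open>y v\<close> lies in
        \<open>X\<close>, so \<open>v \<in> B = D\<close> and \<open>y v \<in> xR\<close>. All
        summands of \<open>z\<close> are thus in \<open>xR\<close>.\<close>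
      then have sA: "s g \<in> A" if "g \<in> F" for g using p(3) tight that by blast
      have wx: "w \<in> xR" unfolding s
        using sA AD Dx F(3) by (intro R.subspace_sum[OF ixR]) blast
      have wc: "w \<in> c" unfolding s
        using Am[OF sA] F(3) by (intro R.subspace_sum[OF c(1)]) blast
      have "y * v = x * (- u) + (z - w)" using w(1) by simp
      also have "\<dots> \<in> X" unfolding X_def using R.subspace_diff[OF c(1) z wc] xxR
        by (intro set_plus_intro)
      finally have "v \<in> B" by (simp add: B_def)
      then have "y * v \<in> xR" using Dx[of v y] F(4) BD by (simp add: mult.commute)
      then show "z \<in> xR"
        unfolding w(1) using wx xxR by (intro R.subspace_add[OF ixR])
    qed
    then show False using c(4) unfolding xR_def by blast
  qed
  \<comment> \<open>Comparing \<open>n = 1 + p + b' + a\<close> with \<open>n = b' + j + d\<close>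
    gives \<open>d = 1 + p + a - j\<close>. The strict loss just established absorbs the unit and
    leaves \<open>d \<le> (card F + 1) a\<close>.\<close>
  then have "1 + p \<le> card F * a + j" using p(1) by linarith
  then have "d \<le> card G * a" using qd(3) b'(2) j(2) F(2) by simp
  then have "d + e \<le> card G * n + 1" using e_le ab(3) by (simp add: distrib_left)
  then show ?thesis using qd(2) by (auto simp: D_def)
qed

section \<open>The integral closure\<close>

interpretation Q: module "scale_tfrac :: 'a::comm_ring_1 \<Rightarrow> 'a tfrac \<Rightarrow> 'a tfrac"
  by (rule module_tfrac)

lemma of_ring_eq_0_iff [simp]: "of_ring a = 0 \<longleftrightarrow> a = 0"
  using of_ring_eq_iff[of a 0] by simp

lemma of_ring_minus: "of_ring (- a) = - of_ring a"
proof -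
  have "of_ring (- a) + of_ring a = of_ring (- a + a)" by (rule of_ring_add[symmetric])
  then show ?thesis by (simp add: eq_neg_iff_add_eq_0)
qed

lemma of_ring_sum: "of_ring (sum f A) = (\<Sum>i\<in>A. of_ring (f i))"
  by (induction A rule: infinite_finite_induct) (simp_all add: of_ring_add)

lemma of_ring_power: "of_ring (a ^ n) = of_ring a ^ n"
  by (induction n) (simp_all add: of_ring_mult)

lemma of_ring_cancel:
  assumes "non_zero_divisor d" "of_ring d * y = of_ring d * z"
  shows "y = z"
proof -
  have "tfrac_inverse_of d * (of_ring d * y) = tfrac_inverse_of d * (of_ring d * z)"
    using assms(2) by simp
  moreover have "tfrac_inverse_of d * (of_ring d * y) = y" for y
    using of_ring_mult_inverse[OF assms(1)] by (metis mult.assoc mult.commute mult_1)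
  ultimately show ?thesis by simp
qed

lemma range_of_ring_closed:
  fixes y z :: "'a::comm_ring_1 tfrac"
  assumes "y \<in> range of_ring" "z \<in> range of_ring"
  shows "y + z \<in> range of_ring" "y * z \<in> range of_ring"
  using assms by (auto simp: of_ring_add[symmetric] of_ring_mult[symmetric])

lemma module_hom_of_ring: "module_hom (*) scale_tfrac (of_ring :: 'a::comm_ring_1 \<Rightarrow> 'a tfrac)"
  by unfold_locales (simp_all add: scale_tfrac_def of_ring_add of_ring_mult algebra_simps)

lemma subspace_range_of_ring: "module.subspace scale_tfrac (range (of_ring :: 'a::comm_ring_1 \<Rightarrow> 'a tfrac))"
  by (rule module_hom.subspace_image[OF module_hom_of_ring]) simp

text \<open>The combination is indexed by \<open>A\<close> and not by the image set, since
  \<open>f\<close> may repeat values: distinct exponents can give equal powers or monomials.\<close>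

lemma (in module) span_image_finite:
  assumes "finite A" "v \<in> span (f ` A)"
  obtains u where "v = (\<Sum>i\<in>A. scale (u i) (f i))"
proof -
  let ?V = "range (\<lambda>u. \<Sum>i\<in>A. scale (u i) (f i))"
  have "span (f ` A) \<subseteq> ?V"
  proof (rule span_minimal)
    show "f ` A \<subseteq> ?V"
    proof
      fix w assume "w \<in> f ` A"
      then obtain j where j: "j \<in> A" "w = f j" by blast
      have "(\<Sum>i\<in>A. scale (if i = j then 1 else 0) (f i)) = (\<Sum>i\<in>A. if i = j then f i else 0)"
        by (rule sum.cong) auto
      also have "\<dots> = w" using j assms(1) by simp
      finally have e: "(\<Sum>i\<in>A. scale (if i = j then 1 else 0) (f i)) = w" .
      show "w \<in> ?V" unfolding e[symmetric] by (rule rangeI)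
    qed
    show "subspace ?V"
    proof (rule subspaceI)
      show "0 \<in> ?V" by (rule range_eqI[of _ _ "\<lambda>_. 0"]) simp
    next
      fix v w assume "v \<in> ?V" "w \<in> ?V"
      then obtain a b where "v = (\<Sum>i\<in>A. scale (a i) (f i))" "w = (\<Sum>i\<in>A. scale (b i) (f i))" by blast
      then have e: "v + w = (\<Sum>i\<in>A. scale (a i + b i) (f i))"
        by (simp add: sum.distrib scale_left_distrib)
      show "v + w \<in> ?V" unfolding e by (rule rangeI)
    next
      fix c v assume "v \<in> ?V"
      then obtain a where "v = (\<Sum>i\<in>A. scale (a i) (f i))" by blast
      then have e: "scale c v = (\<Sum>i\<in>A. scale (c * a i) (f i))"
        by (simp add: scale_sum_right)
      show "scale c v \<in> ?V" unfolding e by (rule rangeI)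
    qed
  qed
  then show thesis using assms(2) that by blast
qed

text \<open>With \<open>z^n\<close> written as a combination of lower powers with coefficients
  \<open>u i\<close>, the monic polynomial is \<open>X^n\<close> minus the sum of the
  \<open>u i X^i\<close>. Later arguments only produce this span form.\<close>

lemma integral_closureI:
  fixes z :: "'a::comm_ring_1 tfrac"
  assumes "z ^ n \<in> module.span scale_tfrac ((\<lambda>i. z ^ i) ` {..<n})"
  shows "z \<in> integral_closure"
proof -
  obtain u where u: "z ^ n = (\<Sum>i<n. scale_tfrac (u i) (z ^ i))"
    by (rule Q.span_image_finite[OF _ assms]) simp
  define p where "p = monom 1 n - (\<Sum>i<n. monom (u i) i)"
  have cs: "coeff (\<Sum>i<n. monom (u i) i) k = (if k < n then u k else 0)" for k
    by (simp add: coeff_sum)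
  have cp: "coeff p k = (if k = n then 1 else if k < n then - u k else 0)" for k
    using cs[of k] by (simp add: p_def)
  have deg: "degree p = n"
    by (rule antisym[OF degree_le le_degree]) (simp_all add: cp)
  have "poly (map_poly of_ring p) z = (\<Sum>i\<le>n. of_ring (coeff p i) * z ^ i)"
    using deg degree_map_poly[of of_ring p] by (simp add: poly_altdef coeff_map_poly)
  also have "\<dots> = z ^ n + (\<Sum>i<n. of_ring (coeff p i) * z ^ i)"
    by (simp add: lessThan_Suc_atMost[symmetric] cp add.commute)
  also have "(\<Sum>i<n. of_ring (coeff p i) * z ^ i) = (\<Sum>i<n. - scale_tfrac (u i) (z ^ i))"
    by (rule sum.cong) (simp_all add: cp scale_tfrac_def of_ring_minus)
  also have "z ^ n + \<dots> = 0" using u by (simp add: sum_negf)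
  finally have "poly (map_poly of_ring p) z = 0" .
  moreover have "lead_coeff p = 1" using deg cp by simp
  ultimately show ?thesis unfolding integral_closure_def by blast
qed

text \<open>For \<open>z = a/b\<close> with a monic equation of degree \<open>n\<close>, the element
  \<open>b^n\<close> clears the denominators of all powers: below \<open>n\<close> directly, from
  \<open>n\<close> on by reducing to lower powers. Over a Noetherian ring the converse holds too,
  and closure under sums and products is read off from common denominators.\<close>

lemma integral_closure_denominator:
  fixes z :: "'a::comm_ring_1 tfrac"
  assumes "z \<in> integral_closure"
  obtains d where "non_zero_divisor d" "\<And>k. of_ring d * z ^ k \<in> range of_ring"
proof -
  obtain p :: "'a poly" where p: "lead_coeff p = 1" "poly (map_poly of_ring p) z = 0"
    using assms unfolding integral_closure_def by blast
  obtain a b where ab: "non_zero_divisor b" "z = of_ring a * tfrac_inverse_of b"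
    by (rule tfrac_is_fraction)
  have bz: "of_ring b * z = of_ring a"
    using of_ring_mult_inverse[OF ab(1)] by (simp add: ab(2) mult.left_commute)
  define n where "n = degree p"
  have "degree (map_poly of_ring p) = n"
    unfolding n_def by (rule degree_map_poly) simp
  then have "(\<Sum>i\<le>n. of_ring (coeff p i) * z ^ i) = 0"
    using p(2) by (simp add: poly_altdef coeff_map_poly)
  then have zn: "z ^ n = (\<Sum>i<n. of_ring (- coeff p i) * z ^ i)"
    using p(1) by (simp add: lessThan_Suc_atMost[symmetric] n_def of_ring_minus sum_negf
        add.commute eq_neg_iff_add_eq_0)
  have "of_ring (b ^ n) * z ^ k \<in> range of_ring" for k
  proof (induction k rule: less_induct)
    case (less k)
    show ?case
    proof (cases "k < n")
      case True
      then have "b ^ n = b ^ (n - k) * b ^ k" by (simp add: power_add[symmetric])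
      then have "of_ring (b ^ n) * z ^ k = of_ring (b ^ (n - k)) * (of_ring b * z) ^ k"
        by (simp add: of_ring_mult of_ring_power power_mult_distrib mult.assoc)
      also have "\<dots> = of_ring (b ^ (n - k) * a ^ k)" by (simp add: bz of_ring_mult of_ring_power)
      finally show ?thesis by simp
    next
      case False
      then have "z ^ k = z ^ n * z ^ (k - n)" by (simp add: power_add[symmetric])
      then have "of_ring (b ^ n) * z ^ k =
          (\<Sum>i<n. of_ring (- coeff p i) * (of_ring (b ^ n) * z ^ (i + (k - n))))"
        by (simp add: zn sum_distrib_left sum_distrib_right power_add ac_simps)
      also have "\<dots> \<in> range of_ring"
      proof (rule Q.subspace_sum[OF subspace_range_of_ring])
        fix i assume "i \<in> {..<n}"
        then have "i + (k - n) < k" using False by simp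
        then show "of_ring (- coeff p i) * (of_ring (b ^ n) * z ^ (i + (k - n))) \<in> range of_ring"
          by (intro range_of_ring_closed less rangeI)
      qed
      finally show ?thesis .
    qed
  qed
  then show thesis using that[of "b ^ n"] non_zero_divisor_power[OF ab(1)] by blast
qed

text \<open>The elements \<open>d z^k\<close> generate a finitely generated ideal of
  \<open>R\<close>, so some \<open>d z^n\<close> is a combination of the earlier ones; cancelling
  \<open>d\<close> gives the integral equation.\<close>

lemma integral_if_denominator:
  fixes z :: "'a::comm_ring_1 tfrac"
  assumes noeth: "noetherian TYPE('a)"
    and d: "non_zero_divisor d" "\<And>k. of_ring d * z ^ k \<in> range of_ring"
  shows "z \<in> integral_closure"
proof -
  have "\<forall>k. \<exists>r. of_ring d * z ^ k = of_ring r" using d(2) by blast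
  then obtain r where r: "\<And>k. of_ring d * z ^ k = of_ring (r k)" by metis
  obtain B where B: "finite B" "ideal_generated (range r) = ideal_generated B"
    using noeth unfolding noetherian_def by (metis R.subspace_span)
  let ?V = "\<Union>n. ideal_generated (r ` {..<n :: nat})"
  have mono: "ideal_generated (r ` {..<i}) \<subseteq> ideal_generated (r ` {..<j})" if "i \<le> j" for i j :: nat
    by (intro R.span_mono image_mono) (use that in auto)
  have "ideal_generated (range r) \<subseteq> ?V"
  proof (rule R.span_minimal)
    show "range r \<subseteq> ?V"
    proof
      fix w assume "w \<in> range r"
      then obtain k where "w = r k" by blast
      then have "w \<in> ideal_generated (r ` {..<Suc k})" by (intro R.span_base) auto
      then show "w \<in> ?V" by blast
    qed
    show "ideal ?V"
    proof (rule R.subspaceI)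
      show "0 \<in> ?V" using R.span_zero by blast
    next
      fix v w assume "v \<in> ?V" "w \<in> ?V"
      then obtain i j where "v \<in> ideal_generated (r ` {..<i})" "w \<in> ideal_generated (r ` {..<j})" by blast
      then have "v + w \<in> ideal_generated (r ` {..<max i j})"
        using mono[of i "max i j"] mono[of j "max i j"] by (intro R.span_add) auto
      then show "v + w \<in> ?V" by blast
    next
      fix c v assume "v \<in> ?V"
      then show "c * v \<in> ?V" using R.span_scale by blast
    qed
  qed
  then have "\<forall>b\<in>B. \<exists>n. b \<in> ideal_generated (r ` {..<n})"
    using B(2) R.span_superset[of B] by blast
  then obtain f where f: "\<And>b. b \<in> B \<Longrightarrow> b \<in> ideal_generated (r ` {..<f b})" by metis
  \<comment> \<open>The sum is a common upper bound of all \<open>f b\<close>, also when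
    \<open>B\<close> is empty.\<close>
  define n where "n = sum f B"
  have "B \<subseteq> ideal_generated (r ` {..<n})"
  proof
    fix b assume b: "b \<in> B"
    then have "f b \<le> n" unfolding n_def using B(1) by (simp add: member_le_sum)
    then show "b \<in> ideal_generated (r ` {..<n})" using f[OF b] mono by blast
  qed
  then have "ideal_generated B \<subseteq> ideal_generated (r ` {..<n})" by (rule R.span_minimal) simp
  moreover have "r n \<in> ideal_generated (range r)" by (intro R.span_base rangeI)
  ultimately have "r n \<in> ideal_generated (r ` {..<n})" using B(2) by blast
  then obtain u where u: "r n = (\<Sum>i<n. u i * r i)"
    by (rule R.span_image_finite[OF finite_lessThan])
  have "of_ring d * z ^ n = (\<Sum>i<n. of_ring (u i) * (of_ring d * z ^ i))"
    using arg_cong[OF u, of of_ring] by (simp add: r of_ring_sum of_ring_mult)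
  also have "\<dots> = of_ring d * (\<Sum>i<n. of_ring (u i) * z ^ i)"
    by (simp add: sum_distrib_left ac_simps)
  finally have "z ^ n = (\<Sum>i<n. scale_tfrac (u i) (z ^ i))"
    using of_ring_cancel[OF d(1)] by (simp add: scale_tfrac_def)
  also have "\<dots> \<in> Q.span ((\<lambda>i. z ^ i) ` {..<n})"
    by (intro Q.span_sum Q.span_scale Q.span_base) auto
  finally show ?thesis by (rule integral_closureI)
qed

lemma of_ring_integral: "of_ring a \<in> integral_closure"
proof -
  have "of_ring a ^ 1 = scale_tfrac a (of_ring a ^ 0)" by (simp add: scale_tfrac_def)
  also have "\<dots> \<in> Q.span ((\<lambda>i. of_ring a ^ i) ` {..<1})"
    by (intro Q.span_scale Q.span_base) simp
  finally show ?thesis by (rule integral_closureI)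
qed

lemma integral_closure_mult:
  fixes y z :: "'a::comm_ring_1 tfrac"
  assumes noeth: "noetherian TYPE('a)" and yz: "y \<in> integral_closure" "z \<in> integral_closure"
  shows "y * z \<in> integral_closure"
proof -
  obtain d e where de: "non_zero_divisor d" "non_zero_divisor e"
      "\<And>k. of_ring d * y ^ k \<in> range of_ring" "\<And>k. of_ring e * z ^ k \<in> range of_ring"
    using integral_closure_denominator[OF yz(1)] integral_closure_denominator[OF yz(2)] by metis
  have eq: "of_ring (d * e) * (y * z) ^ k = (of_ring d * y ^ k) * (of_ring e * z ^ k)" for k
    by (simp add: of_ring_mult power_mult_distrib ac_simps)
  show ?thesis
    by (rule integral_if_denominator[OF noeth non_zero_divisor_mult[OF de(1,2)]])
      (unfold eq, intro range_of_ring_closed de)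
qed

lemma integral_closure_add:
  fixes y z :: "'a::comm_ring_1 tfrac"
  assumes noeth: "noetherian TYPE('a)" and yz: "y \<in> integral_closure" "z \<in> integral_closure"
  shows "y + z \<in> integral_closure"
proof -
  obtain d e where de: "non_zero_divisor d" "non_zero_divisor e"
      "\<And>k. of_ring d * y ^ k \<in> range of_ring" "\<And>k. of_ring e * z ^ k \<in> range of_ring"
    using integral_closure_denominator[OF yz(1)] integral_closure_denominator[OF yz(2)] by metis
  have of_nat: "of_nat j \<in> range of_ring" for j :: nat
    by (induction j) (use range_of_ring_closed[of 1] in \<open>auto simp: of_ring_add[symmetric] simp flip: of_ring_0 of_ring_1\<close>)
  have eq: "of_ring (d * e) * (y + z) ^ k =
      (\<Sum>i\<le>k. of_nat (k choose i) * ((of_ring d * y ^ i) * (of_ring e * z ^ (k - i))))" for k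
    by (simp add: of_ring_mult binomial_ring sum_distrib_left ac_simps)
  show ?thesis
    by (rule integral_if_denominator[OF noeth non_zero_divisor_mult[OF de(1,2)]])
      (unfold eq, intro Q.subspace_sum[OF subspace_range_of_ring] range_of_ring_closed of_nat de)
qed

lemma subspace_integral_closure:
  assumes noeth: "noetherian TYPE('a::comm_ring_1)"
  shows "module.subspace scale_tfrac (integral_closure :: 'a tfrac set)"
proof (rule Q.subspaceI)
  show "0 \<in> (integral_closure :: 'a tfrac set)" using of_ring_integral[of 0] by simp
  show "scale_tfrac c x \<in> integral_closure" if "x \<in> integral_closure" for c and x :: "'a tfrac"
    unfolding scale_tfrac_def by (intro integral_closure_mult noeth of_ring_integral that)
qed (rule integral_closure_add[OF noeth])

section \<open>Principal reductions\<close>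

lemma residue_class_eq_iff:
  assumes "ideal I"
  shows "residue_class I x = residue_class I y \<longleftrightarrow> x - y \<in> I"
proof
  assume "residue_class I x = residue_class I y"
  moreover have "x \<in> residue_class I x" using R.subspace_0[OF assms] by (simp add: residue_class_def)
  ultimately show "x - y \<in> I" by (simp add: residue_class_def)
next
  assume xy: "x - y \<in> I"
  have "z - x \<in> I \<longleftrightarrow> z - y \<in> I" for z
    using R.subspace_add[OF assms _ xy, of "z - x"] R.subspace_diff[OF assms _ xy, of "z - y"] by auto
  then show "residue_class I x = residue_class I y" by (simp add: residue_class_def)
qed

text \<open>A polynomial over the field \<open>R/m\<close> with infinitely many roots vanishes. The
  argument stays in \<open>R\<close>: \<open>U\<close> has pairwise distinct residues, a root
  \<open>a\<close> is split off by synthetic division, and primality of \<open>m\<close> moves the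
  other roots to the quotient.\<close>

lemma coeffs_in_maximal_if_roots:
  fixes p :: "'a::comm_ring_1 poly" and m :: "'a set"
  assumes loc: "noetherian_local_ring m"
    and "degree p \<le> n" "infinite U" "inj_on (residue_class m) U" "\<And>u. u \<in> U \<Longrightarrow> poly p u \<in> m"
  shows "coeff p i \<in> m"
  using assms(2-)
proof (induction n arbitrary: p U i)
  case 0
  then have "degree p = 0" by simp
  then obtain c where c: "p = [:c:]" by (rule degree_eq_zeroE)
  obtain u where "u \<in> U" using 0(2) by fastforce
  then have "c \<in> m" using 0(4) c by fastforce
  then show ?case using c R.subspace_0[OF noetherian_local_ringD(2)[OF loc]]
    by (simp add: coeff_pCons split: nat.split)
next
  case (Suc n)
  note im = noetherian_local_ringD(2)[OF loc]
  obtain a where a: "a \<in> U" using Suc.prems(2) by fastforce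
  define q where "q = synthetic_div p a"
  have p: "p = [:- a, 1:] * q + [:poly p a:]"
    unfolding q_def by (rule synthetic_div_correct'[symmetric])
  have pa: "poly p a \<in> m" using Suc.prems(4) a by blast
  have q: "coeff q j \<in> m" for j
  proof (rule Suc.IH[of _ "U - {a}"])
    show "degree q \<le> n" using Suc.prems(1) by (simp add: q_def degree_synthetic_div)
    show "infinite (U - {a})" using Suc.prems(2) by simp
    show "inj_on (residue_class m) (U - {a})" by (rule inj_on_subset[OF Suc.prems(3)]) blast
    fix u assume u: "u \<in> U - {a}"
    have "poly p u = (u - a) * poly q u + poly p a" by (subst p) (simp add: algebra_simps)
    then have "(u - a) * poly q u = poly p u - poly p a" by simp
    also have "\<dots> \<in> m" using Suc.prems(4)[of u] u by (intro R.subspace_diff[OF im] pa) auto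
    finally have "u - a \<in> m \<or> poly q u \<in> m"
      using maximal_prime[OF loc] unfolding prime_ideal_def by blast
    moreover have "u - a \<notin> m"
      using residue_class_eq_iff[OF im] inj_onD[OF Suc.prems(3), of u a] u a by blast
    ultimately show "poly q u \<in> m" by blast
  qed
  have "coeff p i = - a * coeff q i + (case i of 0 \<Rightarrow> poly p a | Suc j \<Rightarrow> coeff q j)"
    by (subst p) (simp add: coeff_pCons split: nat.split)
  also have "\<dots> \<in> m"
    using q pa by (intro R.subspace_add[OF im] ideal_mult_left[OF im]) (simp_all split: nat.split)
  finally show ?case .
qed

lemma exists_non_root_modulo_maximal:
  fixes p :: "'a::comm_ring_1 poly" and m :: "'a set"
  assumes loc: "noetherian_local_ring m" and inf: "infinite (residue_ring m)" and i: "coeff p i \<notin> m"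
  obtains u where "poly p u \<notin> m"
proof -
  define U where "U = inv_into UNIV (residue_class m) ` residue_ring m"
  have "inj_on (inv_into UNIV (residue_class m)) (residue_ring m)"
    unfolding residue_ring_def by (rule inj_on_inv_into) simp
  then have "infinite U" unfolding U_def using inf finite_image_iff by blast
  moreover have "inj_on (residue_class m) U"
    unfolding U_def residue_ring_def by (rule inj_onI) (auto simp: f_inv_into_f)
  ultimately have "\<exists>u\<in>U. poly p u \<notin> m"
    using coeffs_in_maximal_if_roots[OF loc order_refl, of U p i] i by blast
  then show thesis using that by blast
qed

lemma power_span_shift:
  fixes z :: "'a::comm_ring_1 tfrac"
  assumes "t \<in> module.span scale_tfrac ((\<lambda>i. z ^ i) ` {..<n})"
  shows "z ^ j * t \<in> module.span scale_tfrac ((\<lambda>i. z ^ i) ` {..<n + j})"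
proof -
  let ?T = "Q.span ((\<lambda>i. z ^ i) ` {..<n + j})"
  have "Q.span ((\<lambda>i. z ^ i) ` {..<n}) \<subseteq> {t. z ^ j * t \<in> ?T}"
  proof (rule Q.span_minimal)
    show "(\<lambda>i. z ^ i) ` {..<n} \<subseteq> {t. z ^ j * t \<in> ?T}"
      by (auto simp: power_add[symmetric] intro!: Q.span_base)
    show "Q.subspace {t. z ^ j * t \<in> ?T}"
    proof (rule Q.subspaceI)
      fix c t assume "t \<in> {t. z ^ j * t \<in> ?T}"
      then have "scale_tfrac c (z ^ j * t) \<in> ?T" by (intro Q.span_scale) simp
      then show "scale_tfrac c t \<in> {t. z ^ j * t \<in> ?T}" by (simp add: scale_tfrac_def mult.left_commute)
    qed (simp_all add: Q.span_zero distrib_left Q.span_add)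
  qed
  then show ?thesis using assms by blast
qed

text \<open>For \<open>w = x + u y\<close> and \<open>z = y/w\<close> one has
  \<open>x/w = 1 - u z\<close>. A form in \<open>x\<close> and \<open>y\<close> divided by a power
  of \<open>w\<close> thus becomes a polynomial in \<open>z\<close>, whose top coefficient is
  isolated here.\<close>

lemma linear_power_leading_term:
  fixes z :: "'a::comm_ring_1 tfrac"
  shows "(1 - of_ring u * z) ^ n - of_ring ((- u) ^ n) * z ^ n
    \<in> module.span scale_tfrac ((\<lambda>i. z ^ i) ` {..<n})"
proof (induction n)
  case 0
  then show ?case by simp
next
  case (Suc n)
  let ?T = "\<lambda>n. Q.span ((\<lambda>i. z ^ i) ` {..<n})"
  define t where "t = (1 - of_ring u * z) ^ n - of_ring ((- u) ^ n) * z ^ n"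
  have t1: "t \<in> ?T n" using Suc by (simp add: t_def)
  have "?T n \<subseteq> ?T (Suc n)" by (intro Q.span_mono image_mono) auto
  then have t: "t \<in> ?T (Suc n)" "z * t \<in> ?T (Suc n)"
    using t1 power_span_shift[OF t1, of 1] by auto
  have "(1 - of_ring u * z) ^ n = of_ring ((- u) ^ n) * z ^ n + t" by (simp add: t_def)
  then have "(1 - of_ring u * z) ^ Suc n - of_ring ((- u) ^ Suc n) * z ^ Suc n
      = (scale_tfrac ((- u) ^ n) (z ^ n) + t) - scale_tfrac u (z * t)"
    by (simp add: scale_tfrac_def of_ring_mult of_ring_minus algebra_simps)
  also have "\<dots> \<in> ?T (Suc n)"
    by (intro Q.span_diff Q.span_add Q.span_scale t Q.span_base) auto
  finally show ?case .
qed

text \<open>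
  With \<open>k = \<ell>(R/aR)\<close> and \<open>J = (x, y)\<^sup>k\<close> one has \<open>\<ell>(J/aJ) = k\<close>, whereas \<open>J\<close> is generated by \<open>k + 1\<close>
  monomials; hence one of them is redundant modulo \<open>aJ\<close> and the preceding ones.
\<close>

lemma homogeneous_relation:
  fixes x y :: "'a::comm_ring_1" and m :: "'a set"
  assumes loc: "noetherian_local_ring m" and dim: "krull_dim TYPE('a) = 1"
    and a: "a \<in> m" "non_zero_divisor a" and x: "non_zero_divisor x"
  obtains k i c where "i \<le> k" "(\<Sum>j\<le>k. c j * (x ^ (k - j) * y ^ j)) = 0" "c i \<notin> m"
proof -
  note im = noetherian_local_ringD(2)[OF loc]
  obtain k where k: "residue_length (range ((*) a)) = enat k"
    using residue_length_finite[OF loc dim ideal_range_mult a(2)] rangeI[of "(*) a" 1] by auto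
  define g where "g j = x ^ (k - j) * y ^ j" for j
  define J where "J = ideal_generated (g ` {..k})"
  have iJ: "ideal J" unfolding J_def by simp
  have "g 0 \<in> J" unfolding J_def by (intro R.span_base) simp
  then have xJ: "x ^ k \<in> J" by (simp add: g_def)
  define aJ where "aJ = (*) a ` J"
  have iaJ: "ideal aJ" unfolding aJ_def by (rule ideal_image_mult[OF iJ])
  have aJJ: "aJ \<subseteq> J" unfolding aJ_def using ideal_mult_left[OF iJ] by blast
  have aJR: "aJ \<subseteq> range ((*) a)" unfolding aJ_def by blast
  \<comment> \<open>Both sides are the length of \<open>R/aJ\<close>, computed through
    \<open>J\<close> and through \<open>aR\<close>, where \<open>aR/aJ\<close> is isomorphic to
    \<open>R/J\<close>. The finite length of \<open>R/J\<close> may be cancelled because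
    \<open>J\<close> contains the non-zero divisor \<open>x^k\<close>.\<close>
  have "residue_length J + quotient_length (*) J aJ = enat k + residue_length J"
    using residue_length_add[OF iJ aJJ] residue_length_add[OF ideal_range_mult aJR] k
      quotient_length_mult_nonzerodivisor[OF R.subspace_UNIV iJ subset_UNIV a(2)]
    by (simp add: aJ_def)
  moreover have "residue_length J \<noteq> \<infinity>"
    by (rule residue_length_finite[OF loc dim iJ non_zero_divisor_power[OF x] xJ])
  ultimately have lJ: "quotient_length (*) J aJ = enat k"
    by (cases "residue_length J"; cases "quotient_length (*) J aJ") auto
  define C where "C i = aJ + ideal_generated (g ` {..<i})" for i
  have iC: "ideal (C i)" for i unfolding C_def by (intro subspace_set_plus[OF module_ring] iaJ) simp
  have "\<exists>i\<le>k. C i = C (Suc i)"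
  proof (rule ccontr)
    assume "\<not> ?thesis"
    then have ne: "C i \<noteq> C (Suc i)" if "i < Suc k" for i using that by auto
    have "submodule_chain (*) J aJ (Suc k) C"
      unfolding submodule_chain_def
    proof (intro conjI allI impI iC)
      show "aJ \<subseteq> C 0" unfolding C_def by (rule subset_set_plus_left[OF module_ring]) simp
      show "C (Suc k) \<subseteq> J"
        unfolding C_def lessThan_Suc_atMost J_def[symmetric]
        by (intro set_plus_least[OF module_ring] iJ aJJ order_refl)
      fix i assume "i < Suc k"
      moreover have "C i \<subseteq> C (Suc i)"
        unfolding C_def by (intro set_plus_mono2 R.span_mono image_mono) auto
      ultimately show "C i \<subset> C (Suc i)" using ne by blast
    qed
    then have "enat (Suc k) \<le> enat k" using quotient_length_ge[OF module_ring] lJ by metis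
    then show False by simp
  qed
  then obtain i where i: "i \<le> k" "C i = C (Suc i)" by blast
  have "g i \<in> ideal_generated (g ` {..<Suc i})" by (intro R.span_base) simp
  then have "g i \<in> C (Suc i)"
    unfolding C_def using subset_set_plus_right[OF module_ring iaJ] by blast
  then have "g i \<in> C i" using i(2) by simp
  then obtain v w where vw: "g i = a * v + w" "v \<in> J" "w \<in> ideal_generated (g ` {..<i})"
    unfolding C_def aJ_def by (auto elim!: set_plus_elim)
  obtain r where r: "v = (\<Sum>j\<le>k. r j * g j)"
    using R.span_image_finite[OF finite_atMost vw(2)[unfolded J_def]] by blast
  obtain s where s: "w = (\<Sum>j<i. s j * g j)"
    using R.span_image_finite[OF finite_lessThan vw(3)] by blast
  \<comment> \<open>The relation is \<open>g i - a v - w = 0\<close> with \<open>v\<close> and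
    \<open>w\<close> expanded. Its coefficient at \<open>i\<close> is \<open>1 - a * r i\<close>, a
    unit since \<open>a \<in> m\<close>.\<close>
  define c where "c j = (if j = i then 1 else 0) - a * r j - (if j < i then s j else 0)" for j
  have "(\<Sum>j\<le>k. (if j = i then 1 else 0) * g j) = (\<Sum>j\<le>k. if j = i then g j else 0)"
    by (rule sum.cong) auto
  also have "\<dots> = g i" using i(1) by simp
  finally have s1: "(\<Sum>j\<le>k. (if j = i then 1 else 0) * g j) = g i" .
  have "w = (\<Sum>j<i. (if j < i then s j else 0) * g j)" unfolding s by (rule sum.cong) auto
  also have "\<dots> = (\<Sum>j\<le>k. (if j < i then s j else 0) * g j)"
    by (rule sum.mono_neutral_left) (use i(1) in auto)
  finally have s2: "(\<Sum>j\<le>k. (if j < i then s j else 0) * g j) = w" by simp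
  have "(\<Sum>j\<le>k. c j * g j) = g i - a * v - w"
    unfolding c_def left_diff_distrib sum_subtractf s1 s2 r sum_distrib_left by (simp add: mult.assoc)
  then have "(\<Sum>j\<le>k. c j * g j) = 0" using vw(1) by simp
  moreover have "c i \<notin> m"
  proof
    assume "c i \<in> m"
    then have "1 - a * r i \<in> m" by (simp add: c_def)
    from R.subspace_add[OF im this ideal_mult_right[OF im a(1)]]
    show False using one_notin_maximal[OF loc] by (metis diff_add_cancel)
  qed
  ultimately show thesis using that[OF i(1)] unfolding g_def by blast
qed

text \<open>Substituting \<open>x = w - u y\<close> into a homogeneous relation of degree
  \<open>k\<close> gives a relation between \<open>w\<close> and \<open>y\<close>, in which
  \<open>y^k\<close> has the coefficient obtained by putting \<open>x = - u\<close> and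
  \<open>y = 1\<close>. This is a polynomial in \<open>u\<close> that is non-zero modulo
  \<open>m\<close>, so an infinite residue field supplies a \<open>u\<close> with unit value;
  dividing by \<open>w^k\<close> then makes \<open>y/w\<close> integral.\<close>

lemma two_generator_reduction:
  fixes x y :: "'a::comm_ring_1" and m :: "'a set"
  assumes loc: "noetherian_local_ring m" and dim: "krull_dim TYPE('a) = 1"
    and inf: "infinite (residue_ring m)"
    and a: "a \<in> m" "non_zero_divisor a" and x: "non_zero_divisor x"
  obtains u where "non_zero_divisor (x + u * y)"
    "of_ring y * tfrac_inverse_of (x + u * y) \<in> integral_closure"
proof -
  obtain k i c where i: "i \<le> k" and rel: "(\<Sum>j\<le>k. c j * (x ^ (k - j) * y ^ j)) = 0" and ci: "c i \<notin> m"
    by (rule homogeneous_relation[OF loc dim a x])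
  note im = noetherian_local_ringD(2)[OF loc]
  define p where "p = (\<Sum>j\<le>k. monom (c j * (- 1) ^ (k - j)) (k - j))"
  have "coeff p (k - i) = (\<Sum>j\<le>k. if j = i then c j * (- 1) ^ (k - j) else 0)"
    unfolding p_def coeff_sum using i by (intro sum.cong) auto
  also have "\<dots> = c i * (- 1) ^ (k - i)" using i by simp
  finally have "coeff p (k - i) * (- 1) ^ (k - i) = c i"
    by (simp add: mult.assoc power_mult_distrib[symmetric])
  then have "coeff p (k - i) \<notin> m" using ideal_mult_right[OF im] ci by metis
  then obtain u where u: "poly p u \<notin> m" by (rule exists_non_root_modulo_maximal[OF loc inf])
  define v where "v = poly p u"
  have v: "v = (\<Sum>j\<le>k. c j * (- u) ^ (k - j))"
    unfolding v_def p_def poly_sum poly_monom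
    by (intro sum.cong) (simp_all add: power_minus[of u] mult.assoc)
  obtain v' where v': "v * v' = 1" using unit_if_notin_maximal[OF loc u] unfolding v_def by blast
  define w where "w = x + u * y"
  \<comment> \<open>If \<open>w s = 0\<close>, then \<open>x s = - u y s\<close>, and the relation
    multiplied by \<open>s\<close> becomes \<open>v y^k s = 0\<close>. As \<open>v\<close> is a
    unit, \<open>y^k s\<close> and hence \<open>x^k s\<close> vanish, which leaves
    \<open>s = 0\<close>.\<close>
  have nw: "non_zero_divisor w"
    unfolding non_zero_divisor_def
  proof (intro allI impI)
    fix s assume "w * s = 0"
    then have xs: "x * s = - u * y * s" by (simp add: w_def algebra_simps eq_neg_iff_add_eq_0)
    have xn: "x ^ n * s = (- u) ^ n * y ^ n * s" for n
    proof (induction n)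
      case (Suc n)
      have "x ^ Suc n * s = x * (x ^ n * s)" by (simp add: mult.assoc)
      also have "\<dots> = (- u) ^ n * y ^ n * (x * s)" unfolding Suc by (simp add: ac_simps)
      also have "\<dots> = (- u) ^ Suc n * y ^ Suc n * s" unfolding xs by (simp add: ac_simps)
      finally show ?case .
    qed simp
    have "0 = (\<Sum>j\<le>k. c j * (x ^ (k - j) * y ^ j)) * s" using rel by simp
    also have "\<dots> = (\<Sum>j\<le>k. c j * y ^ j * (x ^ (k - j) * s))"
      unfolding sum_distrib_right by (intro sum.cong) (simp_all add: ac_simps)
    also have "\<dots> = (\<Sum>j\<le>k. c j * (- u) ^ (k - j) * (y ^ k * s))"
    proof (rule sum.cong)
      fix j assume "j \<in> {..k}"
      then have "y ^ k = y ^ j * y ^ (k - j)" by (simp add: power_add[symmetric])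
      then show "c j * y ^ j * (x ^ (k - j) * s) = c j * (- u) ^ (k - j) * (y ^ k * s)"
        unfolding xn by (simp add: ac_simps)
    qed simp
    also have "\<dots> = v * (y ^ k * s)" by (simp add: v sum_distrib_right)
    finally have "v' * (v * (y ^ k * s)) = 0" by simp
    then have "y ^ k * s = 0" using v' by (metis mult.assoc mult.commute mult_1)
    then have "x ^ k * s = 0" unfolding xn by (simp add: mult.assoc)
    then show "s = 0" using non_zero_divisor_power[OF x, of k] unfolding non_zero_divisor_def by blast
  qed
  define e where "e = tfrac_inverse_of w"
  define z where "z = of_ring y * e"
  let ?T = "Q.span ((\<lambda>i. z ^ i) ` {..<k})"
  have "of_ring w * e = 1" unfolding e_def by (rule of_ring_mult_inverse[OF nw])
  then have xe: "of_ring x * e = 1 - of_ring u * z"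
    by (simp add: w_def z_def of_ring_add of_ring_mult algebra_simps)
  have "0 = of_ring (\<Sum>j\<le>k. c j * (x ^ (k - j) * y ^ j)) * e ^ k" using rel by simp
  also have "\<dots> = (\<Sum>j\<le>k. of_ring (c j) * (of_ring x ^ (k - j) * of_ring y ^ j * e ^ k))"
    by (simp add: of_ring_sum of_ring_mult of_ring_power sum_distrib_right mult.assoc)
  also have "\<dots> = (\<Sum>j\<le>k. of_ring (c j) * (z ^ j * (1 - of_ring u * z) ^ (k - j)))"
  proof (rule sum.cong)
    fix j assume "j \<in> {..k}"
    then have "e ^ k = e ^ (k - j) * e ^ j" by (simp add: power_add[symmetric])
    then show "of_ring (c j) * (of_ring x ^ (k - j) * of_ring y ^ j * e ^ k) =
        of_ring (c j) * (z ^ j * (1 - of_ring u * z) ^ (k - j))"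
      unfolding xe[symmetric] by (simp add: z_def power_mult_distrib ac_simps)
  qed simp
  finally have rel': "(\<Sum>j\<le>k. of_ring (c j) * (z ^ j * (1 - of_ring u * z) ^ (k - j))) = 0" by simp
  have "(\<Sum>j\<le>k. scale_tfrac (c j) (z ^ j * ((1 - of_ring u * z) ^ (k - j) - of_ring ((- u) ^ (k - j)) * z ^ (k - j)))) \<in> ?T"
  proof (intro Q.span_sum Q.span_scale)
    fix j assume "j \<in> {..k}"
    then show "z ^ j * ((1 - of_ring u * z) ^ (k - j) - of_ring ((- u) ^ (k - j)) * z ^ (k - j)) \<in> ?T"
      using power_span_shift[OF linear_power_leading_term[of u z "k - j"], of j] by simp
  qed
  also have "(\<Sum>j\<le>k. scale_tfrac (c j) (z ^ j * ((1 - of_ring u * z) ^ (k - j) - of_ring ((- u) ^ (k - j)) * z ^ (k - j))))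
      = 0 - (\<Sum>j\<le>k. of_ring (c j * (- u) ^ (k - j)) * z ^ k)"
    unfolding rel'[symmetric] sum_subtractf[symmetric]
  proof (rule sum.cong)
    fix j assume "j \<in> {..k}"
    then have "z ^ k = z ^ j * z ^ (k - j)" by (simp add: power_add[symmetric])
    then show "scale_tfrac (c j) (z ^ j * ((1 - of_ring u * z) ^ (k - j) - of_ring ((- u) ^ (k - j)) * z ^ (k - j)))
        = of_ring (c j) * (z ^ j * (1 - of_ring u * z) ^ (k - j)) - of_ring (c j * (- u) ^ (k - j)) * z ^ k"
      by (simp add: scale_tfrac_def of_ring_mult right_diff_distrib ac_simps)
  qed simp
  also have "(\<Sum>j\<le>k. of_ring (c j * (- u) ^ (k - j)) * z ^ k) = of_ring v * z ^ k"
    by (simp add: v of_ring_sum sum_distrib_right)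
  finally have "scale_tfrac (- v') (0 - of_ring v * z ^ k) \<in> ?T" by (rule Q.span_scale)
  moreover have "scale_tfrac (- v') (0 - of_ring v * z ^ k) = of_ring (v * v') * z ^ k"
    by (simp add: scale_tfrac_def of_ring_mult of_ring_minus ac_simps)
  ultimately have "z ^ k \<in> ?T" by (simp add: v')
  then have "z \<in> integral_closure" by (rule integral_closureI)
  then show thesis using that[of u] nw unfolding w_def z_def e_def by blast
qed

text \<open>The conclusion says \<open>IS = tS\<close> for the integral closure \<open>S\<close>.
  Generators \<open>y\<close> are absorbed one at a time by passing from \<open>t\<close> to
  \<open>t' = t + u y\<close>; earlier quotients stay integral since
  \<open>r/t' = (r/t) (t/t')\<close> and \<open>t/t' = 1 - u (y/t')\<close>.\<close>

lemma principal_reduction: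
  fixes I m :: "'a::comm_ring_1 set"
  assumes loc: "noetherian_local_ring m" and dim: "krull_dim TYPE('a) = 1"
    and inf: "infinite (residue_ring m)" and a: "a \<in> m" "non_zero_divisor a"
    and I: "ideal I" "x \<in> I" "non_zero_divisor x"
  obtains t where "t \<in> I" "non_zero_divisor t"
    "\<And>r. r \<in> I \<Longrightarrow> of_ring r * tfrac_inverse_of t \<in> integral_closure"
proof -
  note noeth = noetherian_local_ringD(1)[OF loc]
  note iS = subspace_integral_closure[OF noeth]
  have "\<exists>t\<in>I. non_zero_divisor t \<and> (\<forall>r\<in>F. of_ring r * tfrac_inverse_of t \<in> integral_closure)"
    if "finite F" "F \<subseteq> I" for F
    using that
  proof (induction F rule: finite_induct)
    case empty
    then show ?case using I by blast
  next
    case (insert y F)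
    then obtain t where t: "t \<in> I" "non_zero_divisor t"
        "\<And>r. r \<in> F \<Longrightarrow> of_ring r * tfrac_inverse_of t \<in> integral_closure"
      by auto
    obtain u where u: "non_zero_divisor (t + u * y)"
        "of_ring y * tfrac_inverse_of (t + u * y) \<in> integral_closure"
      by (rule two_generator_reduction[OF loc dim inf a t(2)])
    define e where "e = tfrac_inverse_of (t + u * y)"
    have "of_ring (t + u * y) * e = 1" unfolding e_def by (rule of_ring_mult_inverse[OF u(1)])
    then have "of_ring t * e = 1 - scale_tfrac u (of_ring y * e)"
      by (simp add: scale_tfrac_def of_ring_add of_ring_mult algebra_simps)
    also have "\<dots> \<in> integral_closure"
      using u(2) of_ring_integral[of 1] by (intro Q.subspace_diff[OF iS] Q.subspace_scale[OF iS]) (simp_all add: e_def)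
    finally have te: "of_ring t * e \<in> integral_closure" .
    have re: "of_ring r * e \<in> integral_closure" if "r \<in> insert y F" for r
    proof (cases "r = y")
      case True then show ?thesis using u(2) by (simp add: e_def)
    next
      case False
      then have r: "of_ring r * tfrac_inverse_of t \<in> integral_closure" using that t(3) by blast
      have "of_ring r * e = of_ring r * e * (of_ring t * tfrac_inverse_of t)"
        using of_ring_mult_inverse[OF t(2)] by simp
      also have "\<dots> = (of_ring r * tfrac_inverse_of t) * (of_ring t * e)" by (simp add: ac_simps)
      also have "\<dots> \<in> integral_closure" by (rule integral_closure_mult[OF noeth r te])
      finally show ?thesis .
    qed
    have "t + u * y \<in> I"
      using insert.prems by (intro R.subspace_add[OF I(1)] t(1) ideal_mult_left[OF I(1)]) auto
    then show ?case using u(1) re unfolding e_def by (intro bexI[of _ "t + u * y"] conjI ballI)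
  qed
  note reduction = this
  obtain F where F: "finite F" "I = ideal_generated F"
    using noeth I(1) unfolding noetherian_def by blast
  then have FI: "F \<subseteq> I" using R.span_superset[of F] by simp
  obtain t where t: "t \<in> I" "non_zero_divisor t"
      "\<And>r. r \<in> F \<Longrightarrow> of_ring r * tfrac_inverse_of t \<in> integral_closure"
    using reduction[OF F(1) FI] by blast
  have "I \<subseteq> {r. of_ring r * tfrac_inverse_of t \<in> integral_closure}"
    unfolding F(2)
  proof (rule R.span_minimal)
    show "F \<subseteq> {r. of_ring r * tfrac_inverse_of t \<in> integral_closure}" using t(3) by blast
    show "ideal {r. of_ring r * tfrac_inverse_of t \<in> integral_closure}"
    proof (rule R.subspaceI)
      show "0 \<in> {r. of_ring r * tfrac_inverse_of t \<in> integral_closure}"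
        using Q.subspace_0[OF iS] by simp
    next
      fix r s assume "r \<in> {r. of_ring r * tfrac_inverse_of t \<in> integral_closure}"
        "s \<in> {r. of_ring r * tfrac_inverse_of t \<in> integral_closure}"
      then show "r + s \<in> {r. of_ring r * tfrac_inverse_of t \<in> integral_closure}"
        using Q.subspace_add[OF iS] by (simp add: of_ring_add distrib_right)
    next
      fix c r assume "r \<in> {r. of_ring r * tfrac_inverse_of t \<in> integral_closure}"
      then show "c * r \<in> {r. of_ring r * tfrac_inverse_of t \<in> integral_closure}"
        using Q.subspace_scale[OF iS] by (simp add: of_ring_mult scale_tfrac_def mult.assoc)
    qed
  qed
  then show thesis using that[OF t(1,2)] by blast
qed

section \<open>Generators of the maximal ideal\<close>

lemma ideal_ideal_mult: "ideal (ideal_mult I J)"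
  unfolding ideal_mult_def by simp

lemma ideal_multI: "a \<in> I \<Longrightarrow> b \<in> J \<Longrightarrow> a * b \<in> ideal_mult I J"
  unfolding ideal_mult_def by (rule R.span_base) blast

lemma ideal_mult_least:
  assumes "ideal K" "\<And>a b. a \<in> I \<Longrightarrow> b \<in> J \<Longrightarrow> a * b \<in> K"
  shows "ideal_mult I J \<subseteq> K"
  unfolding ideal_mult_def by (rule R.span_minimal) (use assms in auto)

lemma ideal_mult_UNIV: "ideal I \<Longrightarrow> ideal_mult I UNIV = (I :: 'a::comm_ring_1 set)"
  using ideal_mult_least[of I I UNIV] ideal_mult_right[of I] ideal_multI[of _ I 1 UNIV] by auto

lemma ideal_power_2: "ideal I \<Longrightarrow> ideal_power I 2 = ideal_mult I (I :: 'a::comm_ring_1 set)"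
  by (simp add: numeral_2_eq_2 ideal_mult_UNIV)

text \<open>Generators are removed one at a time: the hypothesis on \<open>M\<close> gives
  \<open>f = f k + w\<close> with \<open>k \<in> m\<close> and \<open>w\<close> in the span of
  \<open>N\<close> and the other generators, and \<open>1 - k\<close> is a unit.\<close>

lemma nakayama:
  fixes m M N :: "'a::comm_ring_1 set"
  assumes loc: "noetherian_local_ring m" and N: "ideal N" and M: "ideal M" "M \<subseteq> N + ideal_mult m M"
    and F: "finite F" "F \<subseteq> M" "M \<subseteq> N + ideal_generated F"
  shows "M \<subseteq> N"
  using F
proof (induction F rule: finite_induct)
  case empty
  then show ?case by simp
next
  case (insert f F)
  note im = noetherian_local_ringD(2)[OF loc]
  let ?V = "(*) f ` m + (N + ideal_generated F)"
  have iV: "ideal ?V" by (intro subspace_set_plus[OF module_ring] ideal_image_mult im N) simp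
  have iNF: "ideal (N + ideal_generated F)" by (intro subspace_set_plus[OF module_ring] N) simp
  have "ideal_mult m M \<subseteq> ?V"
  proof (rule ideal_mult_least[OF iV])
    fix a b assume a: "a \<in> m" and bM: "b \<in> M"
    have "b \<in> N + (range ((*) f) + ideal_generated F)"
      using subsetD[OF insert.prems(2) bM] unfolding ideal_generated_insert .
    then obtain n k w where b: "b = n + (f * k + w)" "n \<in> N" "w \<in> ideal_generated F"
      by (auto elim!: set_plus_elim)
    have "a * b = f * (a * k) + (a * n + a * w)" by (simp add: b(1) algebra_simps)
    also have "\<dots> \<in> ?V"
      by (intro set_plus_intro imageI ideal_mult_right[OF im a] ideal_mult_left[OF N b(2)] R.span_scale b(3))
    finally show "a * b \<in> ?V" .
  qed
  moreover have "N \<subseteq> ?V"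
    using subset_set_plus_left[OF module_ring, of "ideal_generated F" N]
      subset_set_plus_right[OF module_ring ideal_image_mult[OF im], of "N + ideal_generated F" f]
    by auto
  ultimately have "N + ideal_mult m M \<subseteq> ?V" by (intro set_plus_least[OF module_ring iV])
  then have "f \<in> ?V" using M(2) insert.prems(1) by blast
  then obtain v w where vw: "f = v + w" "v \<in> (*) f ` m" "w \<in> N + ideal_generated F"
    by (rule set_plus_elim)
  obtain k where "v = f * k" "k \<in> m" using vw(2) by blast
  then have k: "f = f * k + w" "k \<in> m" "w \<in> N + ideal_generated F" using vw(1,3) by simp_all
  have "1 - k \<notin> m" using R.subspace_add[OF im _ k(2), of "1 - k"] one_notin_maximal[OF loc] by auto
  then obtain s where s: "(1 - k) * s = 1" by (rule unit_if_notin_maximal[OF loc])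
  have w: "w = f * (1 - k)" using k(1) by (simp add: algebra_simps)
  have "f = s * w" unfolding w using s by (metis mult.assoc mult.commute mult_1)
  then have f: "f \<in> N + ideal_generated F" using ideal_mult_left[OF iNF k(3)] by metis
  have "F \<subseteq> N + ideal_generated F"
    using subset_set_plus_right[OF module_ring N, of "ideal_generated F"] R.span_superset[of F] by blast
  then have "ideal_generated (insert f F) \<subseteq> N + ideal_generated F"
    using f by (intro R.span_minimal iNF) auto
  moreover have "N \<subseteq> N + ideal_generated F" by (rule subset_set_plus_left[OF module_ring]) simp
  ultimately have "N + ideal_generated (insert f F) \<subseteq> N + ideal_generated F"
    by (intro set_plus_least[OF module_ring iNF])
  then show ?case using insert by blast
qed

lemma maximal_generated_modulo_square:
  fixes m :: "'a::comm_ring_1 set"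
  assumes loc: "noetherian_local_ring m" and N: "ideal N" "N \<subseteq> m"
    and F: "m = ideal_generated F" "F \<subseteq> N + ideal_power m 2"
  shows "N = m"
proof
  note im = noetherian_local_ringD(2)[OF loc]
  obtain B where B: "finite B" "m = ideal_generated B"
    using noetherian_local_ringD(1)[OF loc] im unfolding noetherian_def by blast
  have "ideal (N + ideal_mult m m)" by (intro subspace_set_plus[OF module_ring] N ideal_ideal_mult)
  then have "ideal_generated F \<subseteq> N + ideal_mult m m"
    using F(2) unfolding ideal_power_2[OF im] by (intro R.span_minimal)
  then have sq: "m \<subseteq> N + ideal_mult m m" unfolding F(1)[symmetric] .
  have "B \<subseteq> m" unfolding B(2) by (rule R.span_superset)
  moreover have "m \<subseteq> N + ideal_generated B"
    unfolding B(2)[symmetric] by (rule subset_set_plus_right[OF module_ring N(1)])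
  ultimately show "m \<subseteq> N" by (rule nakayama[OF loc N(1) im sq B(1)])
qed fact

lemma exchange_generator:
  fixes m :: "'a::comm_ring_1 set"
  assumes loc: "noetherian_local_ring m" and F: "finite F" "b \<in> F" "r b \<notin> m"
  shows "b \<in> range ((*) (\<Sum>b\<in>F. r b * b)) + ideal_generated (F - {b})"
proof -
  obtain s where s: "r b * s = 1" by (rule unit_if_notin_maximal[OF loc F(3)])
  let ?w = "\<Sum>c\<in>F - {b}. r c * c"
  have sum: "(\<Sum>b\<in>F. r b * b) = r b * b + ?w" by (rule sum.remove[OF F(1,2)])
  have "b = r b * s * b" by (simp add: s)
  also have "\<dots> = (r b * b + ?w) * s + (- s) * ?w" by (simp add: algebra_simps)
  also have "\<dots> \<in> range ((*) (r b * b + ?w)) + ideal_generated (F - {b})"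
    by (intro set_plus_intro rangeI R.span_scale R.span_sum R.span_base)
  finally show ?thesis unfolding sum .
qed

lemma cotangent_basis_exists:
  fixes m :: "'a::comm_ring_1 set"
  assumes loc: "noetherian_local_ring m"
  shows "\<exists>B. cotangent_basis m B"
proof -
  note im = noetherian_local_ringD(2)[OF loc]
  obtain B0 where "finite B0 \<and> m = ideal_generated B0"
    using noetherian_local_ringD(1)[OF loc] im unfolding noetherian_def by blast
  from ex_has_least_nat[of "\<lambda>B. finite B \<and> m = ideal_generated B", OF this, of card]
  obtain B where B: "finite B" "m = ideal_generated B"
      and min: "\<And>C. finite C \<Longrightarrow> m = ideal_generated C \<Longrightarrow> card B \<le> card C"
    by (elim exE conjE) simp
  have Bm: "B \<subseteq> m" unfolding B(2) by (rule R.span_superset)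
  have i2: "ideal (ideal_power m 2)" unfolding ideal_power_2[OF im] by (rule ideal_ideal_mult)
  have "cotangent_basis m B"
    unfolding cotangent_basis_def
  proof (intro conjI allI impI ballI Bm)
    fix F r b assume F: "finite F" "F \<subseteq> B" "(\<Sum>b\<in>F. r b * b) \<in> ideal_power m 2" and b: "b \<in> F"
    show "r b \<in> m"
    proof (rule ccontr)
      assume "r b \<notin> m"
      let ?N = "ideal_generated (B - {b})"
      have "b \<in> range ((*) (\<Sum>b\<in>F. r b * b)) + ideal_generated (F - {b})"
        by (rule exchange_generator[where r = r, OF loc F(1) b \<open>r b \<notin> m\<close>])
      also have "\<dots> \<subseteq> ideal_power m 2 + ?N"
        using ideal_mult_right[OF i2 F(3)] F(2) by (intro set_plus_mono2 R.span_mono) auto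
      finally have "b \<in> ?N + ideal_power m 2" by (simp add: add.commute)
      moreover have "B - {b} \<subseteq> ?N + ideal_power m 2"
        using subset_set_plus_left[OF module_ring i2, of ?N] R.span_superset[of "B - {b}"] by blast
      ultimately have "B \<subseteq> ?N + ideal_power m 2" by blast
      moreover have "?N \<subseteq> m" unfolding B(2) by (intro R.span_mono) blast
      ultimately have "?N = m" by (intro maximal_generated_modulo_square[OF loc _ _ B(2)]) auto
      then have "card B \<le> card (B - {b})" by (intro min) (use B(1) in auto)
      then show False using B(1) b F(2) card_Diff1_less[of B b] by auto
    qed
  next
    fix x assume "x \<in> m"
    then obtain r where "x = (\<Sum>b\<in>B. r b * b)" using B unfolding R.span_finite[OF B(1)] by blast
    then show "\<exists>F r. finite F \<and> F \<subseteq> B \<and> x - (\<Sum>b\<in>F. r b * b) \<in> ideal_power m 2"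
      using B(1) R.subspace_0[OF i2] by (intro exI[of _ B] exI[of _ r]) simp
  qed
  then show ?thesis by blast
qed

text \<open>Finiteness is not part of \<open>cotangent_basis\<close>. Finitely many elements
  \<open>F\<close> of \<open>B\<close> suffice to express generators of \<open>m\<close> modulo its
  square, so \<open>F\<close> generates \<open>m\<close>. A further element of \<open>B\<close>
  would be a combination of \<open>F\<close>, a relation with coefficient \<open>- 1\<close>,
  against independence.\<close>

lemma cotangent_basis_generates:
  fixes m :: "'a::comm_ring_1 set"
  assumes loc: "noetherian_local_ring m" and B: "cotangent_basis m B"
  shows "finite B" "m = ideal_generated B"
proof -
  note im = noetherian_local_ringD(2)[OF loc]
  have i2: "ideal (ideal_power m 2)" unfolding ideal_power_2[OF im] by (rule ideal_ideal_mult)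
  note basis = B[unfolded cotangent_basis_def]
  have Bm: "B \<subseteq> m" by (rule conjunct1[OF basis])
  note ind = conjunct1[OF conjunct2[OF basis], rule_format]
  note gen = conjunct2[OF conjunct2[OF basis], rule_format]
  obtain A where A: "finite A" "m = ideal_generated A"
    using noetherian_local_ringD(1)[OF loc] im unfolding noetherian_def by blast
  have Am: "A \<subseteq> m" unfolding A(2) by (rule R.span_superset)
  have "\<forall>a\<in>A. \<exists>F. finite F \<and> F \<subseteq> B \<and> (\<exists>r. a - (\<Sum>b\<in>F. r b * b) \<in> ideal_power m 2)"
  proof
    fix a assume "a \<in> A"
    then have "a \<in> m" using Am by blast
    from gen[OF this] show "\<exists>F. finite F \<and> F \<subseteq> B \<and> (\<exists>r. a - (\<Sum>b\<in>F. r b * b) \<in> ideal_power m 2)"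
      by simp
  qed
  then obtain f where f: "\<And>a. a \<in> A \<Longrightarrow> finite (f a) \<and> f a \<subseteq> B \<and> (\<exists>r. a - (\<Sum>b\<in>f a. r b * b) \<in> ideal_power m 2)"
    by metis
  define F where "F = (\<Union>a\<in>A. f a)"
  have F: "finite F" "F \<subseteq> B" using A(1) f by (auto simp: F_def)
  have "A \<subseteq> ideal_generated F + ideal_power m 2"
  proof
    fix a assume a: "a \<in> A"
    then obtain r where r: "a - (\<Sum>b\<in>f a. r b * b) \<in> ideal_power m 2" using f by blast
    have "b \<in> F" if "b \<in> f a" for b using a that by (auto simp: F_def)
    then have "(\<Sum>b\<in>f a. r b * b) \<in> ideal_generated F"
      by (intro R.span_sum R.span_scale R.span_base)
    from set_plus_intro[OF this r] show "a \<in> ideal_generated F + ideal_power m 2" by simp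
  qed
  moreover have "ideal_generated F \<subseteq> m" using F(2) Bm by (intro R.span_minimal im) auto
  ultimately have mF: "ideal_generated F = m"
    by (intro maximal_generated_modulo_square[OF loc _ _ A(2)]) auto
  have "B = F"
  proof (rule ccontr)
    assume "B \<noteq> F"
    then obtain b where b: "b \<in> B" "b \<notin> F" using F(2) by blast
    have "b \<in> ideal_generated F" using b(1) Bm mF by blast
    then obtain s where s: "b = (\<Sum>c\<in>F. s c * c)" unfolding R.span_finite[OF F(1)] by blast
    define r where "r c = (if c = b then - 1 else s c)" for c
    have "(\<Sum>c\<in>F. r c * c) = (\<Sum>c\<in>F. s c * c)" using b(2) by (intro sum.cong) (auto simp: r_def)
    then have "(\<Sum>c\<in>insert b F. r c * c) = 0" using F(1) b(2) s by (simp add: r_def)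
    then have "r b \<in> m" using F b(1) R.subspace_0[OF i2] by (intro ind[of "insert b F"]) auto
    then show False using R.subspace_neg[OF im, of "- 1"] one_notin_maximal[OF loc] by (simp add: r_def)
  qed
  then show "finite B" "m = ideal_generated B" using F(1) mF by auto
qed

text \<open>Outside the square of \<open>m\<close>, the element \<open>x\<close> has a unit
  coefficient at some basis element, which it can replace. The definite choice in
  \<open>embedding_dim\<close> is harmless because the argument applies to any cotangent
  basis.\<close>

lemma embedding_dim_generators:
  fixes m :: "'a::comm_ring_1 set"
  assumes loc: "noetherian_local_ring m" and x: "x \<in> m" "x \<notin> ideal_power m 2"
  obtains G where "finite G" "m = ideal_generated (insert x G)" "embedding_dim m = Suc (card G)"
proof -
  note im = noetherian_local_ringD(2)[OF loc]
  define B where "B = (SOME B. cotangent_basis m B)"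
  have "cotangent_basis m B"
    unfolding B_def using cotangent_basis_exists[OF loc] by (rule someI_ex)
  note B = cotangent_basis_generates[OF loc this]
  have Bm: "B \<subseteq> m" unfolding B(2) by (rule R.span_superset)
  obtain r where r: "x = (\<Sum>b\<in>B. r b * b)" using x(1) B unfolding R.span_finite[OF B(1)] by blast
  have "\<exists>b\<in>B. r b \<notin> m"
  proof (rule ccontr)
    assume "\<not> ?thesis"
    then have "x \<in> ideal_mult m m"
      unfolding r using Bm by (intro R.subspace_sum[OF ideal_ideal_mult] ideal_multI) auto
    then show False using x(2) ideal_power_2[OF im] by simp
  qed
  then obtain b where b: "b \<in> B" "r b \<notin> m" by blast
  let ?G = "B - {b}"
  have "b \<in> ideal_generated (insert x ?G)"
    using exchange_generator[where r = r, OF loc B(1) b] unfolding r[symmetric] ideal_generated_insert .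
  moreover have "?G \<subseteq> ideal_generated (insert x ?G)"
    using R.span_superset[of "insert x ?G"] by blast
  ultimately have "ideal_generated B \<subseteq> ideal_generated (insert x ?G)"
    by (intro R.span_minimal) auto
  moreover have "ideal_generated (insert x ?G) \<subseteq> m"
    using x(1) Bm by (intro R.span_minimal im) auto
  ultimately have "m = ideal_generated (insert x ?G)" using B(2) by blast
  moreover have "embedding_dim m = Suc (card ?G)"
    unfolding embedding_dim_def B_def[symmetric] by (rule card_Suc_Diff1[OF B(1) b(1), symmetric])
  ultimately show thesis using that[of ?G] B(1) by blast
qed

section \<open>The conductor and its multiplicity\<close>

lemma conductor_mult_integral:
  fixes r :: "'a::comm_ring_1"
  assumes noeth: "noetherian TYPE('a)" and r: "r \<in> conductor" and s: "s \<in> integral_closure"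
  shows "of_ring r * s \<in> of_ring ` conductor"
proof -
  have r': "of_ring r * u \<in> range of_ring" if "u \<in> integral_closure" for u
    using r that by (simp add: conductor_def colon_def)
  obtain q where q: "of_ring r * s = of_ring q" using r'[OF s] by blast
  have "of_ring q * u \<in> range of_ring" if "u \<in> integral_closure" for u
    using r'[OF integral_closure_mult[OF noeth s that]] by (simp add: q[symmetric] mult.assoc)
  then have "q \<in> conductor" by (simp add: conductor_def colon_def)
  then show ?thesis unfolding q by (rule imageI)
qed

text \<open>\<open>r y = t (r (y/t))\<close>, and the conductor absorbs the integral factor
  \<open>y/t\<close>. This serves for a reduction of the conductor itself, for one of the maximal
  ideal, and with \<open>y = 1\<close> for an integral inverse.\<close>

lemma conductor_mult_reduction:
  fixes r :: "'a::comm_ring_1"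
  assumes noeth: "noetherian TYPE('a)" and r: "r \<in> conductor" and t: "non_zero_divisor t"
    and y: "of_ring y * tfrac_inverse_of t \<in> integral_closure"
  shows "r * y \<in> (*) t ` conductor"
proof -
  obtain q where q: "q \<in> conductor" "of_ring r * (of_ring y * tfrac_inverse_of t) = of_ring q"
    using conductor_mult_integral[OF noeth r y] by auto
  have "of_ring (r * y) = of_ring r * of_ring y * (of_ring t * tfrac_inverse_of t)"
    by (simp add: of_ring_mult of_ring_mult_inverse[OF t])
  also have "\<dots> = of_ring t * (of_ring r * (of_ring y * tfrac_inverse_of t))" by (simp add: ac_simps)
  also have "\<dots> = of_ring (t * q)" by (simp add: q(2) of_ring_mult)
  finally have "r * y = t * q" by simp
  then show ?thesis using q(1) by blast
qed

text \<open>The square of the conductor is \<open>t\<close> times the conductor. The exponents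
  differ by one because only one factor remains after powers of \<open>t\<close> are pulled
  out.\<close>

lemma ideal_conductor_power:
  fixes t :: "'a::comm_ring_1"
  assumes noeth: "noetherian TYPE('a)" and ic: "ideal (conductor :: 'a set)"
    and t: "t \<in> conductor" "non_zero_divisor t"
    and red: "\<And>r. r \<in> conductor \<Longrightarrow> of_ring r * tfrac_inverse_of t \<in> integral_closure"
  shows "ideal_power (conductor :: 'a set) (Suc k) = (*) (t ^ k) ` conductor"
proof (induction k)
  case 0
  have "(*) 1 ` conductor = (conductor :: 'a set)" by force
  then show ?case by (simp add: ideal_mult_UNIV[OF ic])
next
  case (Suc k)
  have "ideal_mult (conductor :: 'a set) ((*) (t ^ k) ` conductor) = (*) (t ^ Suc k) ` conductor"
  proof
    show "ideal_mult (conductor :: 'a set) ((*) (t ^ k) ` conductor) \<subseteq> (*) (t ^ Suc k) ` conductor"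
    proof (rule ideal_mult_least[OF ideal_image_mult[OF ic]])
      fix a b :: 'a assume a: "a \<in> conductor" and "b \<in> (*) (t ^ k) ` conductor"
      then obtain b' where b: "b = t ^ k * b'" "b' \<in> conductor" by blast
      obtain q where q: "a * b' = t * q" "q \<in> conductor"
        using conductor_mult_reduction[OF noeth a t(2) red[OF b(2)]] by blast
      have "a * b = t ^ k * (a * b')" by (simp add: b(1) mult.left_commute)
      also have "\<dots> = t ^ Suc k * q" unfolding q(1) by (simp add: ac_simps)
      finally show "a * b \<in> (*) (t ^ Suc k) ` conductor" using q(2) by blast
    qed
    show "(*) (t ^ Suc k) ` conductor \<subseteq> ideal_mult (conductor :: 'a set) ((*) (t ^ k) ` conductor)"
    proof
      fix z assume "z \<in> (*) (t ^ Suc k) ` conductor"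
      then obtain q where q: "z = t * (t ^ k * q)" "q \<in> conductor" by (auto simp: mult.assoc)
      show "z \<in> ideal_mult conductor ((*) (t ^ k) ` conductor)"
        unfolding q(1) using q(2) by (intro ideal_multI t) blast
    qed
  qed
  then show ?case using Suc by simp
qed

lemma multiplicity_conductor:
  fixes t :: "'a::comm_ring_1"
  assumes noeth: "noetherian TYPE('a)" and dim: "krull_dim TYPE('a) = 1"
    and ic: "ideal (conductor :: 'a set)"
    and t: "t \<in> conductor" "non_zero_divisor t"
    and red: "\<And>r. r \<in> conductor \<Longrightarrow> of_ring r * tfrac_inverse_of t \<in> integral_closure"
    and n: "residue_length (conductor :: 'a set) = enat n"
    and E: "quotient_length (*) (conductor :: 'a set) ((*) t ` conductor) = enat E"
  shows "hilbert_samuel_multiplicity (conductor :: 'a set) = real E"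
proof -
  let ?c = "conductor :: 'a set"
  have tc: "(*) t ` ?c \<subseteq> ?c" using ideal_mult_left[OF ic] by blast
  have len: "residue_length ((*) (t ^ k) ` ?c) = enat (n + k * E)" for k
  proof (induction k)
    case 0
    have "(*) 1 ` ?c = ?c" by force
    then show ?case by (simp add: n)
  next
    case (Suc k)
    have eq: "(*) (t ^ Suc k) ` ?c = (*) (t ^ k) ` ((*) t ` ?c)"
      by (simp add: image_image mult.assoc[symmetric] mult.commute)
    have "residue_length ((*) (t ^ Suc k) ` ?c) =
        residue_length ((*) (t ^ k) ` ?c) + quotient_length (*) ((*) (t ^ k) ` ?c) ((*) (t ^ Suc k) ` ?c)"
      unfolding eq by (intro residue_length_add ideal_image_mult ic image_mono tc)
    also have "quotient_length (*) ((*) (t ^ k) ` ?c) ((*) (t ^ Suc k) ` ?c) = enat E"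
      unfolding eq E[symmetric]
      by (intro quotient_length_mult_nonzerodivisor ic ideal_image_mult tc non_zero_divisor_power t)
    finally show ?case using Suc by (simp add: ac_simps)
  qed
  let ?X = "\<lambda>j. fact 1 * real (the_enat (residue_length (ideal_power ?c j))) / real j ^ 1"
  \<comment> \<open>For \<open>j = k + 1\<close> the length is \<open>n + (j - 1) E\<close>; divided
    by \<open>j\<close> it is \<open>E + (n - E)/j\<close>. The shift makes this valid only for
    \<open>j > 0\<close>.\<close>
  have "(\<lambda>j. real E + (real n - real E) / real j) \<longlonglongrightarrow> real E + 0"
    by (intro tendsto_add tendsto_const lim_const_over_n)
  moreover have "\<forall>\<^sub>F j in sequentially. real E + (real n - real E) / real j = ?X j"
    using eventually_gt_at_top[of 0]
  proof eventually_elim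
    case (elim j)
    then obtain k where k: "j = Suc k" by (cases j) auto
    have "the_enat (residue_length (ideal_power ?c j)) = n + k * E"
      using ideal_conductor_power[OF noeth ic t red, of k] len[of k] unfolding k
      by (simp del: ideal_power.simps)
    then show ?case by (simp add: k field_simps)
  qed
  ultimately have "?X \<longlonglongrightarrow> real E" using Lim_transform_eventually by fastforce
  moreover have "the_enat (1 :: enat) = 1" by (simp add: one_enat_def)
  ultimately show ?thesis
    unfolding hilbert_samuel_multiplicity_def dim Let_def by (simp add: limI)
qed

section \<open>Lengths in the total ring of fractions\<close>

lemma module_hom_mult_tfrac: "module_hom scale_tfrac scale_tfrac ((*) (q :: 'a::comm_ring_1 tfrac))"
  by unfold_locales (simp_all add: scale_tfrac_def algebra_simps)

lemma subspace_image_of_ring: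
  "ideal (I :: 'a::comm_ring_1 set) \<Longrightarrow> module.subspace scale_tfrac (of_ring ` I)"
  by (rule module_hom.subspace_image[OF module_hom_of_ring])

lemma quotient_length_of_ring:
  fixes I K :: "'a::comm_ring_1 set"
  assumes "ideal I" "ideal K" "K \<subseteq> I"
  shows "quotient_length scale_tfrac (of_ring ` I) (of_ring ` K) = quotient_length (*) I K"
proof -
  have "of_ring ` I + of_ring ` K = of_ring ` I"
  proof
    show "of_ring ` I + of_ring ` K \<subseteq> of_ring ` I"
      using assms by (intro set_plus_least[OF module_tfrac] subspace_image_of_ring image_mono) auto
    show "of_ring ` I \<subseteq> of_ring ` I + of_ring ` K"
      by (intro subset_set_plus_left[OF module_tfrac] subspace_image_of_ring assms)
  qed
  moreover have "{v \<in> I. of_ring v \<in> of_ring ` K} = K" using assms(3) by (auto simp: image_iff)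
  ultimately show ?thesis
    using quotient_length_image[OF module_hom_of_ring assms(1) subspace_image_of_ring[OF assms(2)]] by simp
qed

text \<open>Lengths of quotients inside \<open>Q(R)\<close> are computed in \<open>R\<close> by
  clearing a denominator: multiplication by \<open>q\<close> identifies \<open>M/N\<close> with
  \<open>I/K\<close>.\<close>

lemma quotient_length_scaled:
  fixes I K :: "'a::comm_ring_1 set" and M N :: "'a tfrac set"
  assumes "module.subspace scale_tfrac M" "ideal I" "ideal K" "K \<subseteq> I"
    and M: "(*) q ` M = of_ring ` I" and N: "{v \<in> M. q * v \<in> of_ring ` K} = N"
  shows "quotient_length scale_tfrac M N = quotient_length (*) I K"
proof -
  have "of_ring ` I + of_ring ` K = of_ring ` I"
  proof
    show "of_ring ` I + of_ring ` K \<subseteq> of_ring ` I"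
      using assms(2-4) by (intro set_plus_least[OF module_tfrac] subspace_image_of_ring image_mono) auto
    show "of_ring ` I \<subseteq> of_ring ` I + of_ring ` K"
      by (intro subset_set_plus_left[OF module_tfrac] subspace_image_of_ring assms)
  qed
  then show ?thesis
    using quotient_length_image[OF module_hom_mult_tfrac assms(1) subspace_image_of_ring[OF assms(3)], of q]
      quotient_length_of_ring[OF assms(2-4)]
    unfolding M N by simp
qed

lemma mult_inverse_cancel:
  assumes "non_zero_divisor t"
  shows "of_ring t * (z * tfrac_inverse_of t) = z"
  using of_ring_mult_inverse[OF assms] by (metis mult.left_commute mult.right_neutral)

text \<open>Multiplication by \<open>t\<close> maps the integral closure onto the conductor and the
  conductor onto \<open>t\<close> times itself.\<close>

lemma multiplicity_eq_length_integral_closure: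
  fixes t :: "'a::comm_ring_1"
  assumes noeth: "noetherian TYPE('a)" and ic: "ideal (conductor :: 'a set)"
    and t: "t \<in> conductor" "non_zero_divisor t"
    and red: "\<And>r. r \<in> conductor \<Longrightarrow> of_ring r * tfrac_inverse_of t \<in> integral_closure"
  shows "quotient_length scale_tfrac (integral_closure :: 'a tfrac set) (of_ring ` conductor) =
    quotient_length (*) (conductor :: 'a set) ((*) t ` conductor)"
proof (rule quotient_length_scaled[OF subspace_integral_closure[OF noeth] ic ideal_image_mult[OF ic]])
  show "(*) t ` conductor \<subseteq> (conductor :: 'a set)" using ideal_mult_left[OF ic] by blast
  show "(*) (of_ring t) ` integral_closure = of_ring ` conductor"
  proof
    show "(*) (of_ring t) ` integral_closure \<subseteq> of_ring ` conductor"
      using conductor_mult_integral[OF noeth t(1)] by blast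
    show "of_ring ` conductor \<subseteq> (*) (of_ring t) ` integral_closure"
    proof
      fix z :: "'a tfrac" assume "z \<in> of_ring ` conductor"
      then obtain r where r: "r \<in> conductor" "z = of_ring r" by blast
      show "z \<in> (*) (of_ring t) ` integral_closure"
        by (rule image_eqI[OF _ red[OF r(1)]]) (simp add: r(2) mult_inverse_cancel[OF t(2)])
    qed
  qed
  show "{v \<in> integral_closure. of_ring t * v \<in> of_ring ` (*) t ` conductor} = of_ring ` conductor"
  proof (intro equalityI subsetI)
    fix v :: "'a tfrac" assume "v \<in> {v \<in> integral_closure. of_ring t * v \<in> of_ring ` (*) t ` conductor}"
    then obtain r where "r \<in> conductor" "of_ring t * v = of_ring t * of_ring r"
      by (auto simp: of_ring_mult)
    then show "v \<in> of_ring ` conductor" using of_ring_cancel[OF t(2)] by blast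
  qed (auto simp: of_ring_integral of_ring_mult[symmetric])
qed

section \<open>Canonical ideals\<close>

lemma subspace_colon:
  fixes W :: "'a::comm_ring_1 tfrac set"
  assumes "module.subspace scale_tfrac W"
  shows "module.subspace scale_tfrac (colon W V)"
proof (rule Q.subspaceI)
  show "0 \<in> colon W V" using Q.subspace_0[OF assms] by (simp add: colon_def)
  show "y + z \<in> colon W V" if "y \<in> colon W V" "z \<in> colon W V" for y z
    using that Q.subspace_add[OF assms] by (simp add: colon_def distrib_right)
  show "scale_tfrac c z \<in> colon W V" if "z \<in> colon W V" for c z
    using that Q.subspace_scale[OF assms] by (simp add: colon_def scale_tfrac_def mult.assoc)
qed

text \<open>The factor \<open>a\<close> moves \<open>W\<close> into \<open>R\<close>, so
  \<open>W\<close> is isomorphic to the ideal \<open>aW\<close> and finitely generated. This makes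
  the duality of \<open>canonical_ideal\<close> available for every member of a chain between
  \<open>R\<close> and its integral closure.\<close>

lemma fractional_ideal_between:
  fixes W :: "'a::comm_ring_1 tfrac set"
  assumes noeth: "noetherian TYPE('a)" and W: "module.subspace scale_tfrac W"
    and sub: "range of_ring \<subseteq> W" "W \<subseteq> integral_closure"
    and a: "a \<in> (conductor :: 'a set)" "non_zero_divisor a"
  shows "fractional_ideal W"
proof -
  let ?h = "\<lambda>r :: 'a. of_ring r * tfrac_inverse_of a"
  have h: "module_hom (*) scale_tfrac ?h"
    by unfold_locales (simp_all add: scale_tfrac_def of_ring_add of_ring_mult algebra_simps)
  define I where "I = {r. ?h r \<in> W}"
  have "ideal I"
    using module_hom_vimage_subspace[OF h R.subspace_UNIV W] by (simp add: I_def)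
  then obtain F where F: "finite F" "I = ideal_generated F"
    using noeth unfolding noetherian_def by blast
  have "W \<subseteq> ?h ` I"
  proof
    fix w assume w: "w \<in> W"
    then obtain r where r: "of_ring a * w = of_ring r"
      using a(1) sub(2) by (auto simp: conductor_def colon_def)
    have "w = ?h r"
      unfolding r[symmetric] using of_ring_mult_inverse[OF a(2)]
      by (metis mult.assoc mult.commute mult.right_neutral)
    then show "w \<in> ?h ` I" using w unfolding I_def by blast
  qed
  then have "W = ?h ` I" unfolding I_def by blast
  then have "W = Q.span (?h ` F)" unfolding F(2) module_hom.span_image[OF h, symmetric] .
  moreover have "1 \<in> W" using sub(1) by (metis of_ring_1 rangeI subsetD)
  ultimately show ?thesis
    unfolding fractional_ideal_def using W F(1) by (metis finite_imageI non_zero_divisor_1)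
qed

lemma colon_canonical_self:
  fixes \<omega> :: "'a::comm_ring_1 tfrac set"
  assumes can: "canonical_ideal \<omega>" and R: "fractional_ideal (range of_ring :: 'a tfrac set)"
  shows "colon \<omega> \<omega> = range of_ring"
proof -
  have W: "Q.subspace \<omega>" using can by (simp add: canonical_ideal_def fractional_ideal_def)
  have "colon \<omega> (range of_ring) = \<omega>"
  proof
    show "colon \<omega> (range of_ring) \<subseteq> \<omega>"
    proof
      fix z assume "z \<in> colon \<omega> (range of_ring)"
      then have "z * of_ring 1 \<in> \<omega>" unfolding colon_def by blast
      then show "z \<in> \<omega>" by simp
    qed
    show "\<omega> \<subseteq> colon \<omega> (range of_ring)"
      using Q.subspace_scale[OF W] by (auto simp: colon_def scale_tfrac_def mult.commute)
  qed
  then show ?thesis using can R unfolding canonical_ideal_def by metis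
qed

text \<open>Dualizing \<open>J \<mapsto> \<omega> : J\<close> turns chains between \<open>\<omega>\<close> and the integral closure into chains between the
  conductor and \<open>R = \<omega> : \<omega>\<close>.\<close>

lemma quotient_length_canonical_le:
  fixes \<omega> :: "'a::comm_ring_1 tfrac set"
  assumes noeth: "noetherian TYPE('a)" and can: "canonical_ideal \<omega>"
    and sub: "range of_ring \<subseteq> \<omega>" "\<omega> \<subseteq> integral_closure"
    and a: "a \<in> (conductor :: 'a set)" "non_zero_divisor a"
  shows "quotient_length scale_tfrac integral_closure \<omega> \<le> residue_length (conductor :: 'a set)"
proof (rule quotient_length_le[OF module_tfrac])
  fix n C assume C: "submodule_chain scale_tfrac integral_closure \<omega> n C"
  have W: "Q.subspace \<omega>" using can by (simp add: canonical_ideal_def fractional_ideal_def)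
  have "range of_ring \<subseteq> (integral_closure :: 'a tfrac set)" using sub by blast
  note fR = fractional_ideal_between[OF noeth subspace_range_of_ring order_refl this a]
  note self = colon_canonical_self[OF can fR]
  have Ci: "\<omega> \<subseteq> C i" "C i \<subseteq> integral_closure" "Q.subspace (C i)" if "i \<le> n" for i
    using chain_mono[OF module_tfrac C, of 0 i] chain_mono[OF module_tfrac C, of i n] C that
    by (auto simp: submodule_chain_def)
  have dual: "colon \<omega> (colon \<omega> (C i)) = C i" if "i \<le> n" for i
  proof -
    have "fractional_ideal (C i)"
      by (rule fractional_ideal_between[OF noeth Ci(3)[OF that] order_trans[OF sub(1) Ci(1)[OF that]]
            Ci(2)[OF that] a])
    then show ?thesis using can unfolding canonical_ideal_def by blast
  qed
  \<comment> \<open>Dualizing reverses inclusions, hence the index \<open>n - i\<close>. The duals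
    lie in \<open>R\<close> because \<open>\<omega> : C \<subseteq> \<omega> : \<omega>\<close> for
    \<open>\<omega> \<subseteq> C\<close>, and distinct members have distinct duals by
    \<open>dual\<close>.\<close>
  define D where "D i = {r. of_ring r \<in> colon \<omega> (C (n - i))}" for i
  have img: "of_ring ` D i = colon \<omega> (C (n - i))" for i
  proof -
    have "colon \<omega> (C (n - i)) \<subseteq> colon \<omega> \<omega>" using Ci(1)[of "n - i"] by (auto simp: colon_def)
    then show ?thesis unfolding self D_def by auto
  qed
  have "submodule_chain (*) UNIV (conductor :: 'a set) n D"
    unfolding submodule_chain_def
  proof (intro conjI allI impI)
    show "conductor \<subseteq> D 0"
    proof
      fix r :: 'a assume "r \<in> conductor"
      then show "r \<in> D 0" using Ci(2)[of n] sub(1) by (auto simp: D_def conductor_def colon_def)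
    qed
    show "ideal (D i)" if "i \<le> n" for i
      using module_hom_vimage_subspace[OF module_hom_of_ring R.subspace_UNIV subspace_colon[OF W]]
      by (simp add: D_def)
    fix i assume i: "i < n"
    then have "Suc (n - Suc i) = n - i" "n - Suc i < n" by auto
    then have Cs: "C (n - Suc i) \<subset> C (n - i)"
      using C unfolding submodule_chain_def by metis
    then have "D i \<subseteq> D (Suc i)" by (auto simp: D_def colon_def)
    moreover have "D i \<noteq> D (Suc i)"
    proof
      assume "D i = D (Suc i)"
      then have "colon \<omega> (C (n - i)) = colon \<omega> (C (n - Suc i))" using img by metis
      then have "C (n - i) = C (n - Suc i)" using dual by (metis diff_le_self)
      then show False using Cs by simp
    qed
    ultimately show "D i \<subset> D (Suc i)" by blast
  qed simp
  then show "enat n \<le> residue_length (conductor :: 'a set)" by (rule quotient_length_ge[OF module_ring])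
qed

section \<open>Almost Gorenstein rings\<close>

text \<open>All \<open>x z^k\<close> stay in \<open>m\<close>, so \<open>x\<close> is a common
  denominator of the powers of \<open>z\<close>.\<close>

lemma colon_maximal_integral:
  assumes noeth: "noetherian TYPE('a::comm_ring_1)" and x: "x \<in> m" "non_zero_divisor x"
  shows "colon (of_ring ` m) (of_ring ` (m :: 'a set)) \<subseteq> integral_closure"
proof
  fix z assume z: "z \<in> colon (of_ring ` m) (of_ring ` m)"
  have "of_ring x * z ^ k \<in> of_ring ` m" for k
  proof (induction k)
    case (Suc k)
    then have "z * (of_ring x * z ^ k) \<in> of_ring ` m" using z unfolding colon_def by blast
    then show ?case by (simp add: mult.left_commute)
  qed (use x(1) in simp)
  then show "z \<in> integral_closure" by (intro integral_if_denominator[OF noeth x(2)]) blast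
qed

theorem theorem9:
  fixes m :: "'a::comm_ring_1 set"
  assumes "noetherian_local_ring m"
    and "krull_dim TYPE('a) = 1"
    and "cohen_macaulay m"
    and "analytically_unramified m"
    and "infinite (residue_ring m)"
    and "primary_to m (conductor :: 'a set)"
    and "almost_gorenstein m"
  shows "hilbert_samuel_multiplicity (conductor :: 'a set) \<le>
    real (embedding_dim m) * real (the_enat (residue_length (conductor :: 'a set)))"
proof -
  note loc = assms(1) and dim = assms(2) and inf = assms(5)
  note noeth = noetherian_local_ringD(1)[OF loc]
  note im = noetherian_local_ringD(2)[OF loc]
  define S where "S = (integral_closure :: 'a tfrac set)"
  define c where "c = (conductor :: 'a set)"
  have iS: "Q.subspace S" unfolding S_def by (rule subspace_integral_closure[OF noeth])
  have ic: "ideal c" and cU: "c \<noteq> UNIV" and rad: "ideal_radical c = m"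
    using assms(6) by (simp_all add: c_def primary_to_def primary_ideal_def)
  have cm: "c \<subseteq> m" by (rule proper_ideal_subset_maximal[OF loc ic cU])

  \<comment> \<open>Principal reductions of \<open>m\<close> and of the conductor\<close>
  obtain x0 where x0: "x0 \<in> m" "non_zero_divisor x0"
    by (rule cohen_macaulay_nonzerodivisor[OF dim assms(3)])
  obtain x where x: "x \<in> m" "non_zero_divisor x"
      and xred: "\<And>r. r \<in> m \<Longrightarrow> of_ring r * tfrac_inverse_of x \<in> S"
    using principal_reduction[OF loc dim inf x0 im x0] unfolding S_def by blast
  obtain j where "x0 ^ j \<in> c" using x0(1) rad by (auto simp: ideal_radical_def)
  then obtain t where t: "t \<in> c" "non_zero_divisor t"
      and tred: "\<And>r. r \<in> c \<Longrightarrow> of_ring r * tfrac_inverse_of t \<in> S"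
    using principal_reduction[OF loc dim inf x0 ic _ non_zero_divisor_power[OF x0(2)]] unfolding S_def by blast
  have cS: "of_ring r * s \<in> of_ring ` c" if "r \<in> c" "s \<in> S" for r s
    using conductor_mult_integral[OF noeth] that unfolding c_def S_def by blast
  have cmx: "r * y \<in> (*) x ` c" if "r \<in> c" "y \<in> m" for r y
    using conductor_mult_reduction[OF noeth _ x(2)] xred[OF that(2)] that(1) unfolding c_def S_def by blast
  \<comment> \<open>Otherwise the least power of \<open>x\<close> in \<open>c\<close> could be
    divided by \<open>x\<close>; its exponent is positive because \<open>c\<close> is
    proper.\<close>
  have cxc: "\<not> c \<subseteq> (*) x ` c"
  proof
    assume sub: "c \<subseteq> (*) x ` c"
    define k where "k = (LEAST k. x ^ k \<in> c)"
    have "\<exists>k. x ^ k \<in> c" using x(1) rad by (auto simp: ideal_radical_def)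
    then have k: "x ^ k \<in> c" unfolding k_def by (rule LeastI_ex)
    have "k \<noteq> 0" using k one_notin_proper_ideal[OF ic cU] by (metis power_0)
    then obtain k' where k': "k = Suc k'" by (cases k) auto
    obtain q where "x * x ^ k' = x * q" "q \<in> c" using k sub unfolding k' by auto
    then have "x ^ k' \<in> c" using non_zero_divisor_cancel[OF x(2)] by metis
    then have "k \<le> k'" unfolding k_def by (rule Least_le)
    then show False using k' by simp
  qed

  \<comment> \<open>The lengths of \<open>R/c\<close>, \<open>R/xR\<close> and
    \<open>c/xc\<close>\<close>
  obtain n where n: "residue_length c = enat n"
    using residue_length_finite[OF loc dim ic t(2,1)] by auto
  obtain e where e: "residue_length (range ((*) x)) = enat e"
    using residue_length_finite[OF loc dim ideal_range_mult x(2)] rangeI[of "(*) x" 1] by auto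
  have xc: "(*) x ` c \<subseteq> c" using ideal_mult_left[OF ic] by blast
  \<comment> \<open>\<open>R/xc\<close> is measured through \<open>c\<close> and through
    \<open>xR\<close>, where \<open>xR/xc\<close> is isomorphic to \<open>R/c\<close>.\<close>
  have "residue_length c + quotient_length (*) c ((*) x ` c) = enat e + residue_length c"
    using residue_length_add[OF ic xc] residue_length_add[OF ideal_range_mult image_mono[OF subset_UNIV], of x c]
      quotient_length_mult_nonzerodivisor[OF R.subspace_UNIV ic subset_UNIV x(2)] e
    by metis
  then have lcx: "quotient_length (*) c ((*) x ` c) = enat e"
    using n by (cases "quotient_length (*) c ((*) x ` c)") auto

  \<comment> \<open>The tower \<open>c \<subseteq> C' \<subseteq> R' \<subseteq> S\<close>\<close>
  define R' where "R' = colon (of_ring ` m) (of_ring ` m)"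
  \<comment> \<open>This is \<open>x\<inverse>c\<close>, and \<open>R'\<close> is
    \<open>m : m\<close>.\<close>
  define C' where "C' = {z. of_ring x * z \<in> of_ring ` c}"
  have iR': "Q.subspace R'" unfolding R'_def by (intro subspace_colon subspace_image_of_ring im)
  have iC': "Q.subspace C'"
    using module_hom_vimage_subspace[OF module_hom_mult_tfrac Q.subspace_UNIV subspace_image_of_ring[OF ic]]
    by (simp add: C'_def)
  have R'S: "R' \<subseteq> S" unfolding R'_def S_def by (rule colon_maximal_integral[OF noeth x])
  have cC': "of_ring ` c \<subseteq> C'"
    using ideal_mult_left[OF ic] by (auto simp: C'_def of_ring_mult[symmetric])
  have C'R': "C' \<subseteq> R'"
  proof
    fix z assume "z \<in> C'"
    then obtain r where r: "r \<in> c" "of_ring x * z = of_ring r" by (auto simp: C'_def)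
    have "z * of_ring y \<in> of_ring ` m" if y: "y \<in> m" for y
    proof -
      have "z * of_ring y = (of_ring x * tfrac_inverse_of x) * (z * of_ring y)"
        by (simp add: of_ring_mult_inverse[OF x(2)])
      also have "\<dots> = of_ring r * (of_ring y * tfrac_inverse_of x)"
        unfolding r(2)[symmetric] by (simp add: ac_simps)
      also have "\<dots> \<in> of_ring ` c" by (rule cS[OF r(1) xred[OF y]])
      finally show ?thesis using cm by blast
    qed
    then show "z \<in> R'" by (simp add: R'_def colon_def)
  qed

  \<comment> \<open>The canonical ideal inside \<open>m : m\<close>\<close>
  obtain \<omega> where can: "canonical_ideal \<omega>" and \<omega>: "range of_ring \<subseteq> \<omega>" "\<omega> \<subseteq> S" "\<omega> \<subseteq> R'"
    using assms(7) by (auto simp: almost_gorenstein_def S_def R'_def)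
  have i\<omega>: "Q.subspace \<omega>" using can by (simp add: canonical_ideal_def fractional_ideal_def)
  have "range of_ring \<subseteq> (integral_closure :: 'a tfrac set)" using \<omega> by (auto simp: S_def)
  note fR = fractional_ideal_between[OF noeth subspace_range_of_ring order_refl this t[unfolded c_def]]
  \<comment> \<open>\<open>C'\<close> is closed under multiplication by \<open>S\<close>. If it lay
    in \<open>\<omega>\<close>, then
    \<open>C' S \<omega> \<subseteq> C' \<subseteq> \<omega>\<close> would give
    \<open>C' S \<subseteq> \<omega> : \<omega> = R\<close>, so \<open>C'\<close> would lie in the
    conductor, that is \<open>c \<subseteq> xc\<close>.\<close>
  have C'\<omega>: "\<not> C' \<subseteq> \<omega>"
  proof
    assume sub: "C' \<subseteq> \<omega>"
    have C'S: "z * s \<in> C'" if zs: "z \<in> C'" "s \<in> S" for z s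
    proof -
      obtain r where r: "r \<in> c" "of_ring x * z = of_ring r" using zs(1) by (auto simp: C'_def)
      then have "of_ring x * (z * s) = of_ring r * s" by (simp add: mult.assoc[symmetric])
      then show ?thesis using cS[OF r(1) zs(2)] by (simp add: C'_def)
    qed
    have C'R: "z * s \<in> range of_ring" if z: "z \<in> C'" and s: "s \<in> S" for z s
    proof -
      have "z * s \<in> colon \<omega> \<omega>"
        unfolding colon_def using C'S[OF C'S[OF z s]] \<omega>(2) sub by blast
      then show ?thesis using colon_canonical_self[OF can fR] by simp
    qed
    have C'c: "z \<in> of_ring ` c" if "z \<in> C'" for z
    proof -
      note zs = C'R[OF that]
      have "z \<in> range of_ring" using zs[of 1] of_ring_integral[of 1] by (simp add: S_def)
      then obtain r where r: "z = of_ring r" by blast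
      have "r \<in> c" using zs by (simp add: c_def conductor_def colon_def S_def r)
      then show ?thesis using r by blast
    qed
    have "c \<subseteq> (*) x ` c"
    proof
      fix r assume r: "r \<in> c"
      have "of_ring r * tfrac_inverse_of x \<in> C'" using r by (simp add: C'_def mult_inverse_cancel[OF x(2)])
      then obtain q where q: "q \<in> c" "of_ring r * tfrac_inverse_of x = of_ring q" using C'c by blast
      have "of_ring r = of_ring (x * q)"
        using mult_inverse_cancel[OF x(2), of "of_ring r"] unfolding q(2) by (simp add: of_ring_mult)
      then show "r \<in> (*) x ` c" using q(1) by simp
    qed
    then show False using cxc by blast
  qed

  have cxR: "\<not> c \<subseteq> range ((*) x)"
  proof
    assume sub: "c \<subseteq> range ((*) x)"
    have "C' \<subseteq> range of_ring"
    proof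
      fix z assume "z \<in> C'"
      then obtain r where "r \<in> c" "of_ring x * z = of_ring r" by (auto simp: C'_def)
      then obtain q where "of_ring x * z = of_ring x * of_ring q" using sub by (auto simp: of_ring_mult)
      then have "z = of_ring q" by (rule of_ring_cancel[OF x(2)])
      then show "z \<in> range of_ring" by blast
    qed
    then show False using C'\<omega> \<omega>(1) by blast
  qed

  \<comment> \<open>Products of two elements of \<open>m\<close> divided by the square of
    \<open>x\<close> are integral. For \<open>x\<close> itself this quotient is \<open>1/x\<close>,
    and the conductor would absorb it.\<close>
  have x2: "x \<notin> ideal_power m 2"
  proof
    assume "x \<in> ideal_power m 2"
    let ?e = "tfrac_inverse_of x"
    have "ideal_mult m m \<subseteq> {z. of_ring z * (?e * ?e) \<in> S}"
    proof (rule ideal_mult_least)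
      have h: "module_hom (*) scale_tfrac (\<lambda>z. of_ring z * (?e * ?e))"
        by unfold_locales (simp_all add: scale_tfrac_def of_ring_add of_ring_mult algebra_simps)
      show "ideal {z. of_ring z * (?e * ?e) \<in> S}"
        using module_hom_vimage_subspace[OF h R.subspace_UNIV iS] by simp
      fix a b assume "a \<in> m" "b \<in> m"
      then have "(of_ring a * ?e) * (of_ring b * ?e) \<in> S"
        unfolding S_def by (intro integral_closure_mult[OF noeth] xred[unfolded S_def])
      then show "a * b \<in> {z. of_ring z * (?e * ?e) \<in> S}" by (simp add: of_ring_mult ac_simps)
    qed
    then have "of_ring x * (?e * ?e) \<in> S" using \<open>x \<in> ideal_power m 2\<close> ideal_power_2[OF im] by blast
    then have "of_ring 1 * ?e \<in> integral_closure"
      using of_ring_mult_inverse[OF x(2)] by (simp add: mult.assoc[symmetric] S_def)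
    then have "r * 1 \<in> (*) x ` c" if "r \<in> c" for r
      using conductor_mult_reduction[OF noeth _ x(2)] that unfolding c_def by blast
    then show False using cxc by auto
  qed
  obtain G where G: "finite G" "m = ideal_generated (insert x G)" "embedding_dim m = Suc (card G)"
    by (rule embedding_dim_generators[OF loc x(1) x2])

  define D where "D = {r. \<forall>y\<in>m. r * y \<in> (*) x ` m}"
  obtain d where d: "quotient_length (*) D c = enat d" "d + e \<le> card G * n + 1"
    using quotient_length_colon_bound[OF loc x G(1,2) ic cm cmx cxR n e] unfolding D_def by blast
  have iD: "ideal D"
  proof (rule R.subspaceI)
    show "0 \<in> D" using R.subspace_0[OF ideal_image_mult[OF im]] by (simp add: D_def)
    show "r + s \<in> D" if "r \<in> D" "s \<in> D" for r s
      using that R.subspace_add[OF ideal_image_mult[OF im]] by (simp add: D_def distrib_right)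
    show "k * r \<in> D" if "r \<in> D" for k r
      using that ideal_mult_left[OF ideal_image_mult[OF im]] by (simp add: D_def mult.assoc)
  qed
  have cD: "c \<subseteq> D" unfolding D_def using cmx cm by blast
  \<comment> \<open>Multiplication by \<open>x\<close> carries \<open>R'\<close> onto
    \<open>D\<close> and \<open>C'\<close> onto \<open>c\<close>.\<close>
  have "quotient_length scale_tfrac R' C' = quotient_length (*) D c"
  proof (rule quotient_length_scaled[OF iR' iD ic cD])
    show "(*) (of_ring x) ` R' = of_ring ` D"
    proof (intro equalityI subsetI)
      fix w assume "w \<in> (*) (of_ring x) ` R'"
      then obtain z where z: "z \<in> R'" "w = of_ring x * z" by blast
      have zm: "z * of_ring y \<in> of_ring ` m" if "y \<in> m" for y
        using z(1) that by (simp add: R'_def colon_def)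
      obtain r where r: "w = of_ring r" using zm[OF x(1)] z(2) by (auto simp: mult.commute)
      have "r * y \<in> (*) x ` m" if y: "y \<in> m" for y
      proof -
        obtain q where q: "q \<in> m" "z * of_ring y = of_ring q" using zm[OF y] by blast
        have "of_ring (r * y) = of_ring (x * q)"
          by (simp add: of_ring_mult r[symmetric] z(2) q(2)[symmetric] mult.assoc)
        then show ?thesis using q(1) by simp
      qed
      then show "w \<in> of_ring ` D" unfolding r D_def by blast
    next
      fix w assume "w \<in> of_ring ` D"
      then obtain r where r: "r \<in> D" "w = of_ring r" by blast
      have "(w * tfrac_inverse_of x) * of_ring y \<in> of_ring ` m" if y: "y \<in> m" for y
      proof -
        obtain q where q: "q \<in> m" "r * y = x * q" using r(1) y by (auto simp: D_def)
        have "(w * tfrac_inverse_of x) * of_ring y = of_ring (r * y) * tfrac_inverse_of x"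
          by (simp add: r(2) of_ring_mult ac_simps)
        also have "\<dots> = of_ring q"
          unfolding q(2) using mult_inverse_cancel[OF x(2), of "of_ring q"] by (simp add: of_ring_mult ac_simps)
        finally show ?thesis using q(1) by simp
      qed
      then have "w * tfrac_inverse_of x \<in> R'" by (simp add: R'_def colon_def)
      then show "w \<in> (*) (of_ring x) ` R'"
        by (rule image_eqI[rotated]) (simp add: mult_inverse_cancel[OF x(2)])
    qed
    show "{v \<in> R'. of_ring x * v \<in> of_ring ` c} = C'" using C'R' by (auto simp: C'_def)
  qed
  then have lRC: "quotient_length scale_tfrac R' C' = enat d" by (simp add: d(1))
  have "quotient_length scale_tfrac C' (of_ring ` c) = quotient_length (*) c ((*) x ` c)"
  proof (rule quotient_length_scaled[OF iC' ic ideal_image_mult[OF ic] xc])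
    show "(*) (of_ring x) ` C' = of_ring ` c"
    proof (intro equalityI subsetI)
      fix w assume "w \<in> of_ring ` c"
      then show "w \<in> (*) (of_ring x) ` C'"
        by (intro image_eqI[of _ _ "w * tfrac_inverse_of x"]) (simp_all add: C'_def mult_inverse_cancel[OF x(2)])
    qed (auto simp: C'_def)
    show "{v \<in> C'. of_ring x * v \<in> of_ring ` (*) x ` c} = of_ring ` c"
    proof (intro equalityI subsetI)
      fix v assume "v \<in> {v \<in> C'. of_ring x * v \<in> of_ring ` (*) x ` c}"
      then obtain r where "r \<in> c" "of_ring x * v = of_ring x * of_ring r" by (auto simp: of_ring_mult)
      then show "v \<in> of_ring ` c" using of_ring_cancel[OF x(2)] by blast
    qed (use cC' in \<open>auto simp: of_ring_mult[symmetric]\<close>)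
  qed
  then have lCc: "quotient_length scale_tfrac C' (of_ring ` c) = enat e" by (simp add: lcx)

  have "\<omega> \<noteq> R'" using C'R' C'\<omega> by blast
  then have "1 \<le> quotient_length scale_tfrac R' \<omega>"
    using \<omega>(3) by (intro quotient_length_pos[OF module_tfrac iR' i\<omega>]) auto
  moreover have "quotient_length scale_tfrac S R' + quotient_length scale_tfrac R' \<omega> \<le> enat n"
    using quotient_length_canonical_le[OF noeth can \<omega>(1) _ t[unfolded c_def]] \<omega>(2)
      quotient_length_add[OF module_tfrac iR' \<omega>(3) R'S iS] n
    by (simp add: S_def c_def)
  ultimately obtain s where s: "quotient_length scale_tfrac S R' = enat s" "s + 1 \<le> n"
    by (cases "quotient_length scale_tfrac S R'"; cases "quotient_length scale_tfrac R' \<omega>")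
      (auto simp: one_enat_def)

  \<comment> \<open>The multiplicity as the length of \<open>S/c\<close> along the tower\<close>
  have "quotient_length (*) c ((*) t ` c) = quotient_length scale_tfrac S (of_ring ` c)"
    using multiplicity_eq_length_integral_closure[OF noeth _ _ t(2)] ic t(1) tred
    unfolding c_def S_def by simp
  also have "\<dots> = quotient_length scale_tfrac S R' + quotient_length scale_tfrac R' (of_ring ` c)"
    by (rule quotient_length_add[OF module_tfrac iR' order_trans[OF cC' C'R'] R'S iS])
  also have "quotient_length scale_tfrac R' (of_ring ` c) =
      quotient_length scale_tfrac R' C' + quotient_length scale_tfrac C' (of_ring ` c)"
    by (rule quotient_length_add[OF module_tfrac iC' cC' C'R' iR'])
  finally have E: "quotient_length (*) c ((*) t ` c) = enat (s + (d + e))"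
    by (simp add: s(1) lRC lCc)
  have "hilbert_samuel_multiplicity c = real (s + (d + e))"
    unfolding c_def
    by (rule multiplicity_conductor[OF noeth dim ic[unfolded c_def] t[unfolded c_def] _ n[unfolded c_def] E[unfolded c_def]])
      (use tred in \<open>simp add: c_def S_def\<close>)
  \<comment> \<open>The units cancel:
    \<open>(n - 1) + ((\<nu> - 1) n + 1) = \<nu> n\<close>.\<close>
  moreover have "s + (d + e) \<le> embedding_dim m * n"
    using s(2) d(2) by (simp add: G(3))
  then have "real (s + (d + e)) \<le> real (embedding_dim m) * real n"
    by (metis of_nat_le_iff of_nat_mult)
  ultimately show ?thesis using n by (simp add: c_def)
qed

end
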